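(* Let $X$ be a standard Borel space, let $d\ge 1$, and let $f_1,\dots,f_d:X\to X$ be bounded-to-one Borel functions that commute pairwise, i.e. $f_i(f_j(x))=f_j(f_i(x))$ for all $i,j$ and all $x\in X$. Let $G$ be the Borel graph on $X$ generated by $f_1,\dots,f_d$. Then $G$ is hyperfinite.
   Context: A function $f:X\to X$ is bounded-to-one if there is $k\in\mathbb N$ such that $|f^{-1}(\{y\})|\le k$ for every $y\in X$. The graph generated by $f_1,\dots,f_d$ is the undirected graph on vertex set $X$ in which $x,y$ are adjacent iff $x\ne y$ and, for some $i$, $f_i(x)=y$ or $f_i(y)=x$. A countable Borel equivalence relation $E$ is hyperfinite if there are Borel equivalence relations $E_0\subseteq E_1\subseteq\cdots$, each with all classes finite, such that $E=\bigcup_n E_n$. A Borel graph is hyperfinite if its connectedness relation ($x\sim y$ iff $x,y$ lie in the same connected component) is hyperfinite. *)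

theory Defs
  imports "HOL-Analysis.Analysis"
begin

definition polish_topology :: "'a topology \<Rightarrow> bool" where
  "polish_topology T \<longleftrightarrow> completely_metrizable_space T \<and> separable_space T"

text \<open>Only the carrier and the sigma-algebra of \<open>X\<close> matter; the measure it carries as
  an element of the type \<open>'a measure\<close> plays no role.\<close>

definition standard_borel_space :: "'a measure \<Rightarrow> bool" where
  "standard_borel_space X \<longleftrightarrow>
     (\<exists>T. polish_topology T \<and> topspace T = space X
        \<and> sets X = sigma_sets (space X) {U. openin T U})"

definition bounded_to_one_on :: "'a set \<Rightarrow> ('a \<Rightarrow> 'a) \<Rightarrow> bool" where
  "bounded_to_one_on A f \<longleftrightarrow>
     (\<exists>k::nat. \<forall>y\<in>A. finite (f -` {y} \<inter> A) \<and> card (f -` {y} \<inter> A) \<le> k)"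

text \<open>A simple undirected graph on a vertex set \<open>V\<close> is given by its adjacency relation,
  a symmetric irreflexive subset of \<open>V \<times> V\<close>.\<close>

definition generated_graph :: "'a set \<Rightarrow> 'i set \<Rightarrow> ('i \<Rightarrow> 'a \<Rightarrow> 'a) \<Rightarrow> ('a \<times> 'a) set" where
  "generated_graph V I f =
     {(x, y). x \<in> V \<and> y \<in> V \<and> x \<noteq> y \<and> (\<exists>i\<in>I. f i x = y \<or> f i y = x)}"

definition borel_graph :: "'a measure \<Rightarrow> ('a \<times> 'a) set \<Rightarrow> bool" where
  "borel_graph X G \<longleftrightarrow>
     G \<subseteq> space X \<times> space X \<and> sym G \<and> irrefl G \<and> G \<in> sets (X \<Otimes>\<^sub>M X)"

text \<open>As adjacency is symmetric, two vertices lie in the same connected component iff they are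
  related by the reflexive transitive closure, cut down to the vertex set because
  the closure is reflexive on the whole type.\<close>

definition connectedness_relation :: "'a set \<Rightarrow> ('a \<times> 'a) set \<Rightarrow> ('a \<times> 'a) set" where
  "connectedness_relation V G = {(x, y). x \<in> V \<and> y \<in> V \<and> (x, y) \<in> G\<^sup>*}"

definition borel_equivalence_relation :: "'a measure \<Rightarrow> ('a \<times> 'a) set \<Rightarrow> bool" where
  "borel_equivalence_relation X E \<longleftrightarrow> equiv (space X) E \<and> E \<in> sets (X \<Otimes>\<^sub>M X)"

definition countable_borel_equivalence_relation :: "'a measure \<Rightarrow> ('a \<times> 'a) set \<Rightarrow> bool" where
  "countable_borel_equivalence_relation X E \<longleftrightarrow>
     borel_equivalence_relation X E \<and> (\<forall>C \<in> space X // E. countable C)"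

definition hyperfinite_relation :: "'a measure \<Rightarrow> ('a \<times> 'a) set \<Rightarrow> bool" where
  "hyperfinite_relation X E \<longleftrightarrow>
     countable_borel_equivalence_relation X E \<and>
     (\<exists>F :: nat \<Rightarrow> ('a \<times> 'a) set.
        (\<forall>n. borel_equivalence_relation X (F n) \<and> (\<forall>C \<in> space X // F n. finite C)) \<and>
        (\<forall>n. F n \<subseteq> F (Suc n)) \<and>
        E = (\<Union>n. F n))"

definition hyperfinite_graph :: "'a measure \<Rightarrow> ('a \<times> 'a) set \<Rightarrow> bool" where
  "hyperfinite_graph X G \<longleftrightarrow>
     borel_graph X G \<and> hyperfinite_relation X (connectedness_relation (space X) G)"

end

theory Submission
  imports Defs "HOL-Library.Function_Algebras"
begin

text \<open>
  Write \<open>f\<^sup>a\<close> for the action of \<open>a \<in> \<nat>\<^sup>d\<close>. Points are equivalent iff \<open>f\<^sup>a x = f\<^sup>b y\<close> for some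
  \<open>a\<close>, \<open>b\<close>, so the kernel of a Borel map \<open>h\<close> with \<open>h x = f\<^sup>a x\<close>, where \<open>a\<close> depends on \<open>x\<close> but is bounded, is
  a finite Borel subequivalence relation, and composing such maps gives increasing kernels.
  The key fact is a dimension bound: for every \<open>L\<close> there are \<open>8\<^sup>d + 1\<close> such maps, one of which is
  constant on \<open>{f\<^sup>a x | a \<in> [0,L]\<^sup>d}\<close>, for each \<open>x\<close>. They send \<open>x\<close> to a nearby point of a separated net,
  and \<open>8\<^sup>d + 1\<close> successive nets suffice because the forward cone of a point grows
  polynomially (the backward one does not). Composing, for each fixed index, the maps for fast growing \<open>L\<close>,
  the pigeonhole principle gives each \<open>x\<close> an index for which \<open>x\<close> is eventually merged with all \<open>f\<^sup>a x\<close>.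

  The nets come from a finite Borel colouring separating points \<open>f\<^sup>a x\<close>, \<open>f\<^sup>b x\<close> with small \<open>a\<close>, \<open>b\<close>. This is
  where bounded-to-one is used: the colouring is built by a greedy algorithm that needs images of Borel sets to be
  Borel, which follows from the Novikov separation theorem.
\<close>

section \<open>Coding standard Borel spaces by closed subsets of Baire space\<close>

text \<open>The maps are not injective, so a rule can test forward images only, and a neighbourhood
  of a point is visible only from a point behind it. Hence nets are controlled up to a constant
  displacement: nearby net points become equal after it. The constant 8 comes from three radii. A
  map constant on the cube of side \<open>L\<close> over \<open>x\<close> has to find the same net
  point from everywhere in that cube, so a net point within \<open>L\<close> of the centre seen from
  \<open>x\<close> is searched for within \<open>2 * L\<close>. Two finds differ by at most
  \<open>4 * L\<close>, which is the separation required of a net. Where no net comes within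
  \<open>L\<close>, each has a point within \<open>4 * L\<close>, and too many of these cannot all
  be more than \<open>L\<close> apart. A last obstacle is that the index supplied by the pigeonhole
  principle may vary along an equivalence class. An index good for a point stays good forward, but
  perhaps not backward; the least index that is good somewhere ahead of the point is
  invariant.\<close>

definition decides :: "'a set \<Rightarrow> ('a \<Rightarrow> nat \<Rightarrow> nat) \<Rightarrow> 'a set \<Rightarrow> bool" where
  "decides S \<Phi> B \<longleftrightarrow> (\<exists>n. \<forall>x\<in>S. \<forall>y\<in>S. (\<forall>i<n. \<Phi> x i = \<Phi> y i) \<longrightarrow> (x \<in> B \<longleftrightarrow> y \<in> B))"

text \<open>If \<open>\<Phi>\<close> decides a separating family, this says that \<open>\<Phi>\<close> is injective with closed range, hence that the
  topology it induces is Polish and zero-dimensional; \<open>decides\<close> then says that \<open>B\<close> is clopen.\<close>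

definition closed_code :: "'a set \<Rightarrow> ('a \<Rightarrow> nat \<Rightarrow> nat) \<Rightarrow> bool" where
  "closed_code S \<Phi> \<longleftrightarrow> (\<forall>z. (\<forall>n. \<exists>x\<in>S. \<forall>i<n. \<Phi> x i = z i) \<longrightarrow> (\<exists>x\<in>S. \<Phi> x = z))"

lemma closed_codeD:
  assumes "closed_code S \<Phi>" "\<And>n. \<exists>x\<in>S. \<forall>i<n. \<Phi> x i = z i"
  obtains x where "x \<in> S" "\<Phi> x = z"
  using assms unfolding closed_code_def by blast

lemma decides_Compl: "decides S \<Phi> B \<Longrightarrow> decides S \<Phi> (S - B)"
  unfolding decides_def by blast

text \<open>The least solution of \<open>Q\<close> depends only on the finitely many values up to
  it, and these are eventually all correct. Coordinates of codes are least indices, so this is how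
  they pass to limits.\<close>

lemma eventually_Least_eq:
  fixes P :: "nat \<Rightarrow> nat \<Rightarrow> bool"
  assumes ev: "\<And>p. \<forall>\<^sub>F n in sequentially. P n p \<longleftrightarrow> Q p" and q: "Q q"
  shows "\<forall>\<^sub>F n in sequentially. (LEAST p. P n p) = (LEAST p. Q p)"
proof -
  let ?l = "LEAST p. Q p"
  have "\<forall>\<^sub>F n in sequentially. \<forall>p\<in>{..?l}. P n p \<longleftrightarrow> Q p"
    using ev by (intro eventually_ball_finite) auto
  then show ?thesis
  proof eventually_elim
    case (elim n)
    have "Q ?l" using q by (rule LeastI)
    show ?case
    proof (rule Least_equality)
      show "P n ?l" using elim \<open>Q ?l\<close> by auto
      fix p assume "P n p"
      show "?l \<le> p"
      proof (rule ccontr)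
        assume "\<not> ?l \<le> p"
        then have "Q p" using elim \<open>P n p\<close> by auto
        then show False using \<open>\<not> ?l \<le> p\<close> Least_le by blast
      qed
    qed
  qed
qed

text \<open>The even coordinates make approximations converge; the odd ones record, for each basic open set
  containing the point, a basic open set whose closure witnesses this, which keeps the limit inside.\<close>

lemma (in Metric_space) closed_code_exists:
  assumes compl: mcomplete and sep: "separable_space mtopology"
  shows "\<exists>\<Phi> U. closed_code M \<Phi> \<and> (\<forall>m::nat. openin mtopology (U m)) \<and> (\<forall>m. decides M \<Phi> (U m))
    \<and> (\<forall>W x. openin mtopology W \<and> x \<in> W \<longrightarrow> (\<exists>m. x \<in> U m \<and> U m \<subseteq> W))"
proof -
  obtain C where C: "countable C" "C \<subseteq> M" "mtopology closure_of C = M"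
    using sep unfolding separable_space_def by auto
  define rad where "rad = (\<lambda>m. 1 / real (Suc (snd (prod_decode m))))"
  define U where "U = (\<lambda>m. mball (from_nat_into C (fst (prod_decode m))) (rad m))"
  have opn: "openin mtopology (U m)" for m unfolding U_def by simp
  have UM: "U m \<subseteq> M" for m unfolding U_def by auto
  have small: "\<exists>m. x \<in> U m \<and> rad m < r" if "x \<in> M" "r > 0" for x r
  proof -
    obtain n where n: "1 / real (Suc n) < r"
      using \<open>r > 0\<close> by (meson nat_approx_posE)
    have "x \<in> mtopology closure_of C" using C that by simp
    then obtain c where c: "c \<in> C" "c \<in> mball x (1 / real (Suc n))"
      using that(1) unfolding metric_closure_of
      by (smt (verit, del_insts) mem_Collect_eq divide_pos_pos of_nat_0_less_iff zero_less_Suc)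
    obtain k where k: "from_nat_into C k = c" using C(1) c(1) from_nat_into_to_nat_on by metis
    have "x \<in> U (prod_encode (k, n))"
      using c(2) k by (auto simp: U_def rad_def commute)
    moreover have "rad (prod_encode (k, n)) < r" using n by (simp add: rad_def)
    ultimately show ?thesis by blast
  qed
  have Ud: "d x y < 2 * rad m" if "x \<in> U m" "y \<in> U m" for x y m
    using that triangle''[of x "from_nat_into C (fst (prod_decode m))" y] triangle[of x "from_nat_into C (fst (prod_decode m))" y]
    unfolding U_def by (auto simp: commute)
  have base: "\<exists>p. x \<in> U p \<and> mtopology closure_of (U p) \<subseteq> W" if "openin mtopology W" "x \<in> W" for x W
  proof -
    obtain r where r: "r > 0" "mcball x r \<subseteq> W"
      using \<open>openin mtopology W\<close> \<open>x \<in> W\<close> unfolding openin_mtopology_mcball by blast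
    have xM: "x \<in> M" using that openin_subset by fastforce
    obtain p where p: "x \<in> U p" "rad p < r / 2" using small[OF xM, of "r/2"] r by auto
    have "U p \<subseteq> mcball x r"
    proof
      fix y assume y: "y \<in> U p"
      then show "y \<in> mcball x r" using Ud[OF p(1) y] p(2) xM UM by (auto simp: in_mcball)
    qed
    then have "mtopology closure_of (U p) \<subseteq> mcball x r"
      by (rule closure_of_minimal) simp
    then show ?thesis using p r by blast
  qed
  \<comment> \<open>An odd coordinate is 0 exactly off the basic set; hence the \<open>Suc\<close>
    in it.\<close>
  define \<Phi> where "\<Phi> = (\<lambda>x i. if even i then LEAST p. x \<in> U p \<and> rad p \<le> 1 / real (Suc (i div 2))
      else if x \<in> U (i div 2) then Suc (LEAST p. x \<in> U p \<and> mtopology closure_of (U p) \<subseteq> U (i div 2)) else 0)"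
  have \<Phi>e: "\<Phi> x (2*k) = (LEAST p. x \<in> U p \<and> rad p \<le> 1 / real (Suc k))" for x k
    by (simp add: \<Phi>_def)
  have \<Phi>o: "\<Phi> x (Suc (2*m)) = (if x \<in> U m then Suc (LEAST p. x \<in> U p \<and> mtopology closure_of (U p) \<subseteq> U m) else 0)" for x m
    by (simp add: \<Phi>_def)
  have dec: "decides M \<Phi> (U m)" for m
    unfolding decides_def
  proof (intro exI[of _ "2*m+2"] ballI impI)
    fix x y assume "\<forall>i<2*m+2. \<Phi> x i = \<Phi> y i"
    then have "\<Phi> x (Suc (2*m)) = \<Phi> y (Suc (2*m))" by simp
    then show "x \<in> U m \<longleftrightarrow> y \<in> U m" unfolding \<Phi>o by (auto split: if_splits)
  qed
  have "closed_code M \<Phi>"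
    unfolding closed_code_def
  proof (intro allI impI)
    fix z assume "\<forall>n. \<exists>x\<in>M. \<forall>i<n. \<Phi> x i = z i"
    then obtain \<sigma> where \<sigma>: "\<And>n. \<sigma> n \<in> M" "\<And>n i. i < n \<Longrightarrow> \<Phi> (\<sigma> n) i = z i" by metis
    have ze: "\<sigma> n \<in> U (z (2*k)) \<and> rad (z (2*k)) \<le> 1 / real (Suc k)" if "2*k < n" for n k
    proof -
      have "\<exists>p. \<sigma> n \<in> U p \<and> rad p \<le> 1 / real (Suc k)"
        using small[OF \<sigma>(1)[of n], of "1 / real (Suc k)"] by (auto intro: less_imp_le)
      from LeastI_ex[OF this] show ?thesis using \<sigma>(2)[OF that] unfolding \<Phi>e by simp
    qed
    have zo: "\<sigma> n \<in> U m \<and> \<sigma> n \<in> U q \<and> mtopology closure_of (U q) \<subseteq> U m"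
      if "Suc (2*m) < n" "z (Suc (2*m)) = Suc q" for n m q
    proof -
      have eq: "\<Phi> (\<sigma> n) (Suc (2*m)) = Suc q" using \<sigma>(2)[OF that(1)] that(2) by simp
      then have in1: "\<sigma> n \<in> U m" unfolding \<Phi>o by (auto split: if_splits)
      from LeastI_ex[OF base[OF opn this]] in1 eq show ?thesis unfolding \<Phi>o by auto
    qed
    \<comment> \<open>The coordinate \<open>z (2*k)\<close> names one ball of radius at most
      \<open>1 / (k + 1)\<close> that contains every \<open>\<sigma> n\<close> with
      \<open>n > 2*k\<close>.\<close>
    have "MCauchy \<sigma>"
      unfolding MCauchy_def
    proof (intro conjI allI impI)
      show "range \<sigma> \<subseteq> M" using \<sigma> by auto
      fix \<epsilon> :: real assume "\<epsilon> > 0"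
      then obtain k where k: "1 / real (Suc k) < \<epsilon> / 2" using nat_approx_posE[of "\<epsilon>/2"] by auto
      have "d (\<sigma> n) (\<sigma> n') < \<epsilon>" if "2*k+1 \<le> n" "2*k+1 \<le> n'" for n n'
        using Ud[of "\<sigma> n" "z (2*k)" "\<sigma> n'"] ze[of k n] ze[of k n'] that k by auto
      then show "\<exists>N. \<forall>n n'. N \<le> n \<longrightarrow> N \<le> n' \<longrightarrow> d (\<sigma> n) (\<sigma> n') < \<epsilon>" by blast
    qed
    then obtain x where lim: "limitin mtopology \<sigma> x sequentially"
      using compl unfolding mcomplete_def by blast
    have xM: "x \<in> M" using lim limitin_mspace by blast
    \<comment> \<open>Membership in a basic set passes to the limit both ways: non-membership
      because the set is open, membership because the odd coordinate names a \<open>U q\<close> that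
      contains all late terms and whose closure lies in \<open>U p\<close>.\<close>
    have ev: "\<forall>\<^sub>F n in sequentially. \<sigma> n \<in> U p \<longleftrightarrow> x \<in> U p" for p
    proof (cases "z (Suc (2*p))")
      case 0
      have nin: "\<sigma> n \<notin> U p" if "Suc (2*p) < n" for n
        using \<sigma>(2)[OF that] 0 unfolding \<Phi>o by (auto split: if_splits)
      have "x \<notin> U p"
      proof
        assume "x \<in> U p"
        then have "\<forall>\<^sub>F n in sequentially. \<sigma> n \<in> U p" using lim opn unfolding limitin_def by blast
        then obtain N where "\<And>n. n \<ge> N \<Longrightarrow> \<sigma> n \<in> U p" unfolding eventually_sequentially by blast
        then show False using nin[of "N + 2*p + 2"] by auto
      qed
      then show ?thesis using nin unfolding eventually_sequentially
        by (intro exI[of _ "Suc (Suc (2*p))"]) auto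
    next
      case (Suc q)
      have a: "mtopology closure_of (U q) \<subseteq> U p" using zo[OF _ Suc, of "Suc (Suc (2*p))"] by auto
      have "\<forall>\<^sub>F n in sequentially. \<sigma> n \<in> mtopology closure_of (U q)"
        unfolding eventually_sequentially
      proof (intro exI[of _ "Suc (Suc (2*p))"] allI impI)
        fix n assume "Suc (Suc (2*p)) \<le> n"
        then have "\<sigma> n \<in> U q" using zo[OF _ Suc, of n] by auto
        then show "\<sigma> n \<in> mtopology closure_of U q"
          using closure_of_subset[of "U q" mtopology] UM by auto
      qed
      then have "x \<in> mtopology closure_of (U q)"
        using lim limitin_closedin[OF lim closedin_closure_of] by auto
      then show ?thesis using a zo[OF _ Suc] unfolding eventually_sequentially
        by (intro exI[of _ "Suc (Suc (2*p))"]) auto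
    qed
    have "\<Phi> x i = z i" for i
    proof -
      have "\<forall>\<^sub>F n in sequentially. \<Phi> (\<sigma> n) i = \<Phi> x i"
      proof (cases "even i")
        case True
        then obtain k where i: "i = 2*k" by (elim evenE)
        obtain q where q: "x \<in> U q \<and> rad q \<le> 1 / real (Suc k)"
          using small[OF xM, of "1 / real (Suc k)"] by (auto intro: less_imp_le)
        show ?thesis unfolding i \<Phi>e
          by (rule eventually_Least_eq[where Q = "\<lambda>p. x \<in> U p \<and> rad p \<le> 1 / real (Suc k)", OF _ q], rule eventually_mono[OF ev]) auto
      next
        case False
        then obtain m where i: "i = Suc (2*m)" by (metis oddE Suc_eq_plus1)
        show ?thesis
        proof (cases "x \<in> U m")
          case True
          then obtain q where q: "x \<in> U q \<and> mtopology closure_of (U q) \<subseteq> U m"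
            using base[OF opn True] by auto
          have "\<forall>\<^sub>F n in sequentially. (LEAST p. \<sigma> n \<in> U p \<and> mtopology closure_of (U p) \<subseteq> U m)
              = (LEAST p. x \<in> U p \<and> mtopology closure_of (U p) \<subseteq> U m)"
            by (rule eventually_Least_eq[where Q = "\<lambda>p. x \<in> U p \<and> mtopology closure_of (U p) \<subseteq> U m", OF _ q], rule eventually_mono[OF ev]) auto
          with ev[of m] show ?thesis unfolding i \<Phi>o by eventually_elim (use True in auto)
        next
          case False
          show ?thesis using ev[of m] unfolding i \<Phi>o by eventually_elim (use False in auto)
        qed
      qed
      moreover have "\<forall>\<^sub>F n in sequentially. \<Phi> (\<sigma> n) i = z i"
        using \<sigma>(2) unfolding eventually_sequentially by (intro exI[of _ "Suc i"]) auto
      ultimately have "\<forall>\<^sub>F n in sequentially. \<Phi> x i = z i" by eventually_elim auto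
      then show ?thesis by simp
    qed
    then show "\<exists>x\<in>M. \<Phi> x = z" using xM by blast
  qed
  moreover have "\<exists>m. x \<in> U m \<and> U m \<subseteq> W" if "openin mtopology W" "x \<in> W" for W x
    using base[OF that] closure_of_subset[of "U _" mtopology] UM by (metis order_trans topspace_mtopology)
  ultimately show ?thesis using opn dec by blast
qed

text \<open>The codes are interleaved. A limit yields one point \<open>y j\<close> for each code,
  and these coincide: every code decides \<open>U m\<close>, so any two of them agree on
  \<open>U m\<close> with a common approximating point. In topological terms, Polish topologies
  refining one Hausdorff topology have a Polish join.\<close>

lemma closed_code_join:
  fixes \<Phi> :: "nat \<Rightarrow> 'a \<Rightarrow> nat \<Rightarrow> nat"
  assumes cl: "\<And>j. closed_code S (\<Phi> j)" and dec: "\<And>j m. decides S (\<Phi> j) (U m)"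
    and sep: "\<And>x y. x \<in> S \<Longrightarrow> y \<in> S \<Longrightarrow> (\<And>m::nat. x \<in> U m \<longleftrightarrow> y \<in> U m) \<Longrightarrow> x = y"
  obtains \<Psi> where "closed_code S \<Psi>" "\<And>j B. decides S (\<Phi> j) B \<Longrightarrow> decides S \<Psi> B"
proof -
  define \<Psi> where "\<Psi> = (\<lambda>x i. \<Phi> (fst (prod_decode i)) x (snd (prod_decode i)))"
  have \<Psi>: "\<Psi> x (prod_encode (j, i)) = \<Phi> j x i" for x j i by (simp add: \<Psi>_def)
  have bound: "\<exists>N. \<forall>i<n. prod_encode (j, i) < N" for j n
    using finite_nat_set_iff_bounded[of "(\<lambda>i. prod_encode (j,i)) ` {..<n}"] by auto
  have d: "decides S \<Psi> B" if B: "decides S (\<Phi> j) B" for j B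
  proof -
    obtain n where n: "\<And>x y. x\<in>S \<Longrightarrow> y\<in>S \<Longrightarrow> (\<forall>i<n. \<Phi> j x i = \<Phi> j y i) \<Longrightarrow> (x \<in> B \<longleftrightarrow> y \<in> B)"
      using B unfolding decides_def by blast
    obtain N where N: "\<forall>i<n. prod_encode (j, i) < N" using bound by blast
    show ?thesis unfolding decides_def
    proof (intro exI[of _ N] ballI impI)
      fix x y assume *: "x \<in> S" "y \<in> S" "\<forall>i<N. \<Psi> x i = \<Psi> y i"
      have "\<forall>i<n. \<Phi> j x i = \<Phi> j y i" using * N \<Psi> by metis
      then show "x \<in> B \<longleftrightarrow> y \<in> B" using n * by blast
    qed
  qed
  have "closed_code S \<Psi>"
    unfolding closed_code_def
  proof (intro allI impI)
    fix z assume z: "\<forall>n. \<exists>x\<in>S. \<forall>i<n. \<Psi> x i = z i"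
    have "\<exists>x\<in>S. \<Phi> j x = (\<lambda>i. z (prod_encode (j,i)))" for j
    proof -
      have "\<exists>x\<in>S. \<forall>i<n. \<Phi> j x i = z (prod_encode (j,i))" for n
        using bound[of n j] z \<Psi> by metis
      from closed_codeD[OF cl this] show ?thesis by blast
    qed
    then obtain y where y: "\<And>j. y j \<in> S" "\<And>j. \<Phi> j (y j) = (\<lambda>i. z (prod_encode (j,i)))" by metis
    have y0: "y j = y 0" for j
    proof (rule sep[OF y(1) y(1)])
      fix m
      obtain n where n: "\<And>x y. x\<in>S \<Longrightarrow> y\<in>S \<Longrightarrow> (\<forall>i<n. \<Phi> j x i = \<Phi> j y i) \<Longrightarrow> (x \<in> U m \<longleftrightarrow> y \<in> U m)"
        using dec[of j m] unfolding decides_def by blast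
      obtain n' where n': "\<And>x y. x\<in>S \<Longrightarrow> y\<in>S \<Longrightarrow> (\<forall>i<n'. \<Phi> 0 x i = \<Phi> 0 y i) \<Longrightarrow> (x \<in> U m \<longleftrightarrow> y \<in> U m)"
        using dec[of 0 m] unfolding decides_def by blast
      obtain N where N: "\<forall>i<n. prod_encode (j, i) < N" using bound by blast
      obtain N' where N': "\<forall>i<n'. prod_encode (0, i) < N'" using bound by blast
      obtain x where x: "x \<in> S" "\<forall>i<max N N'. \<Psi> x i = z i" using z by blast
      have "\<forall>i<n. \<Phi> j x i = \<Phi> j (y j) i" using x(2) N \<Psi> y(2) by (metis less_max_iff_disj)
      moreover have "\<forall>i<n'. \<Phi> 0 x i = \<Phi> 0 (y 0) i" using x(2) N' \<Psi> y(2) by (metis less_max_iff_disj)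
      ultimately show "y j \<in> U m \<longleftrightarrow> y 0 \<in> U m" using n n' x(1) y(1) by blast
    qed
    then have "\<Psi> (y 0) i = z i" for i
      using y(2)[of "fst (prod_decode i)"] y0[of "fst (prod_decode i)"] by (simp add: \<Psi>_def)
    then show "\<exists>x\<in>S. \<Psi> x = z" using y(1) by blast
  qed
  with d that show ?thesis by blast
qed

text \<open>Recording only whether \<open>x \<in> (\<Union>j. B j)\<close> would not keep the range closed; the least such \<open>j\<close> does.\<close>

lemma closed_code_Union:
  fixes B :: "nat \<Rightarrow> 'a set"
  assumes cl: "closed_code S \<Phi>" and dec: "\<And>j. decides S \<Phi> (B j)"
  obtains \<Psi> where "closed_code S \<Psi>" "decides S \<Psi> (\<Union>j. B j)" "\<And>C. decides S \<Phi> C \<Longrightarrow> decides S \<Psi> C"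
proof -
  let ?B = "\<Union>j. B j"
  define \<Psi> where "\<Psi> = (\<lambda>x i. case i of 0 \<Rightarrow> if x \<in> ?B then Suc (LEAST j. x \<in> B j) else 0 | Suc i \<Rightarrow> \<Phi> x i)"
  have \<Psi>0: "\<Psi> x 0 = (if x \<in> ?B then Suc (LEAST j. x \<in> B j) else 0)" for x by (simp add: \<Psi>_def)
  have \<Psi>S: "\<Psi> x (Suc i) = \<Phi> x i" for x i by (simp add: \<Psi>_def)
  have agr: "(\<forall>i<n. \<Phi> x i = \<Phi> y i)" if "\<forall>i<Suc n. \<Psi> x i = \<Psi> y i" for x y n
    using that \<Psi>S by (metis Suc_less_eq)
  have 1: "decides S \<Psi> ?B"
    unfolding decides_def
  proof (intro exI[of _ 1] ballI impI)
    fix x y assume "\<forall>i<1. \<Psi> x i = \<Psi> y i"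
    then have "\<Psi> x 0 = \<Psi> y 0" by simp
    then show "x \<in> ?B \<longleftrightarrow> y \<in> ?B" unfolding \<Psi>0 by (auto split: if_splits)
  qed
  have 2: "decides S \<Psi> C" if "decides S \<Phi> C" for C
    using that agr unfolding decides_def by meson
  have "closed_code S \<Psi>"
    unfolding closed_code_def
  proof (intro allI impI)
    fix z assume z: "\<forall>n. \<exists>x\<in>S. \<forall>i<n. \<Psi> x i = z i"
    have "\<exists>x\<in>S. \<forall>i<n. \<Phi> x i = z (Suc i)" for n
    proof -
      obtain x where "x \<in> S" "\<forall>i<Suc n. \<Psi> x i = z i" using z by blast
      then show ?thesis using \<Psi>S by (intro bexI[of _ x]) (auto dest: spec[of _ "Suc _"])
    qed
    from closed_codeD[OF cl this] obtain x where x: "x \<in> S" "\<Phi> x = (\<lambda>i. z (Suc i))" by auto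
    \<comment> \<open>The limit \<open>x\<close> is known only through the coordinates of
      \<open>\<Phi>\<close>. Finitely many \<open>B i\<close> at a time are compared with an
      approximating point that already has the prescribed coordinate 0.\<close>
    have app: "\<exists>y\<in>S. \<Psi> y 0 = z 0 \<and> (\<forall>i\<le>j. y \<in> B i \<longleftrightarrow> x \<in> B i)" for j
    proof -
      have "\<exists>n. \<forall>y\<in>S. (\<forall>k<n. \<Phi> x k = \<Phi> y k) \<longrightarrow> (x \<in> B i \<longleftrightarrow> y \<in> B i)" for i
        using dec[of i] x(1) unfolding decides_def by blast
      then obtain n where n: "\<And>i y. y \<in> S \<Longrightarrow> (\<forall>k<n i. \<Phi> x k = \<Phi> y k) \<Longrightarrow> (x \<in> B i \<longleftrightarrow> y \<in> B i)"
        by metis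
      obtain y where y: "y \<in> S" "\<forall>i<Suc (Max (n ` {..j})). \<Psi> y i = z i" using z by blast
      have "y \<in> B i \<longleftrightarrow> x \<in> B i" if "i \<le> j" for i
      proof -
        have le: "n i \<le> Max (n ` {..j})" using that by (intro Max_ge) auto
        have "\<forall>k<n i. \<Phi> x k = \<Phi> y k"
        proof (intro allI impI)
          fix k assume "k < n i"
          then have "\<Psi> y (Suc k) = z (Suc k)" using y(2) le by auto
          then show "\<Phi> x k = \<Phi> y k" using x(2) \<Psi>S by metis
        qed
        then show ?thesis using n y(1) by blast
      qed
      then show ?thesis using y by auto
    qed
    have "\<Psi> x 0 = z 0"
    proof (cases "z 0")
      case 0
      have "x \<notin> B j" for j using app[of j] 0 unfolding \<Psi>0 by (auto split: if_splits)
      then show ?thesis using 0 by (simp add: \<Psi>0)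
    next
      case (Suc j)
      obtain y where y: "\<Psi> y 0 = Suc j" "\<forall>i\<le>j. y \<in> B i \<longleftrightarrow> x \<in> B i" using app[of j] Suc by auto
      have j: "j = (LEAST j. y \<in> B j)" "y \<in> ?B" using y(1) unfolding \<Psi>0 by (auto split: if_splits)
      have yj: "y \<in> B j" using j LeastI_ex[of "\<lambda>j. y \<in> B j"] by auto
      have "(LEAST j. x \<in> B j) = j"
      proof (rule Least_equality)
        show "x \<in> B j" using y(2) yj by auto
        fix i assume "x \<in> B i"
        show "j \<le> i"
        proof (rule ccontr)
          assume "\<not> j \<le> i"
          then have "i < j" "y \<in> B i" using y(2) \<open>x \<in> B i\<close> by auto
          then show False using j(1) not_less_Least by blast
        qed
      qed
      then show ?thesis using y(2) yj Suc by (auto simp: \<Psi>0)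
    qed
    then have "\<Psi> x i = z i" for i using x(2) \<Psi>S by (cases i) auto
    then show "\<exists>x\<in>S. \<Psi> x = z" using x(1) by blast
  qed
  with 1 2 that show ?thesis by blast
qed

text \<open>This is the classical refinement of a Polish topology that makes countably many given
  Borel sets clopen: the sets decided by some good code include the open sets and are closed under
  complements and countable unions.\<close>

lemma standard_borel_coding:
  assumes "standard_borel_space X"
  obtains U :: "nat \<Rightarrow> 'a set" where "\<And>m. U m \<in> sets X"
    "\<And>x y. x \<in> space X \<Longrightarrow> y \<in> space X \<Longrightarrow> (\<And>m. x \<in> U m \<longleftrightarrow> y \<in> U m) \<Longrightarrow> x = y"
    "\<And>B. range B \<subseteq> sets X \<Longrightarrow> \<exists>\<Phi>. closed_code (space X) \<Phi> \<and> (\<forall>j::nat. decides (space X) \<Phi> (B j))"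
proof -
  obtain T where T: "polish_topology T" "topspace T = space X" "sets X = sigma_sets (space X) {U. openin T U}"
    using assms unfolding standard_borel_space_def by blast
  obtain M d where Md: "Metric_space M d" "Metric_space.mcomplete M d" "T = Metric_space.mtopology M d"
    using T(1) unfolding polish_topology_def completely_metrizable_space_def by blast
  interpret Metric_space M d by fact
  have M: "M = space X" using T(2) Md(3) by simp
  have "separable_space mtopology" using T(1) Md(3) by (simp add: polish_topology_def)
  from closed_code_exists[OF Md(2) this] obtain \<Phi>0 U where ex: "closed_code M \<Phi>0 \<and> (\<forall>m::nat. openin mtopology (U m))
      \<and> (\<forall>m. decides M \<Phi>0 (U m)) \<and> (\<forall>W x. openin mtopology W \<and> x \<in> W \<longrightarrow> (\<exists>m. x \<in> U m \<and> U m \<subseteq> W))"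
    by (elim exE)
  then have 0: "closed_code M \<Phi>0" "\<And>m. openin T (U m)" "\<And>m. decides M \<Phi>0 (U m)"
      "\<And>W x. openin T W \<Longrightarrow> x \<in> W \<Longrightarrow> (\<exists>m. x \<in> U m \<and> U m \<subseteq> W)"
    unfolding Md(3) by simp_all
  have US: "U m \<in> sets X" for m using 0(2) T(3) by auto
  have sep: "x = y" if "x \<in> space X" "y \<in> space X" "\<And>m. x \<in> U m \<longleftrightarrow> y \<in> U m" for x y
  proof (rule ccontr)
    assume "x \<noteq> y"
    moreover have "x \<in> M" "y \<in> M" using that M by auto
    ultimately have "d x y > 0" "openin T (mball x (d x y))" "x \<in> mball x (d x y)"
      unfolding Md(3) by auto
    then obtain m where "x \<in> U m" "U m \<subseteq> mball x (d x y)" using 0(4) by blast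
    then show False using that(3)[of m] by auto
  qed
  \<comment> \<open>Deciding every \<open>U m\<close> is part of the invariant because it is what
    allows codes to be joined.\<close>
  define good where "good = (\<lambda>\<Phi>. closed_code (space X) \<Phi> \<and> (\<forall>m. decides (space X) \<Phi> (U m)))"
  have good0: "good \<Phi>0" using 0 M good_def by auto
  have join: "\<exists>\<Phi>. good \<Phi> \<and> (\<forall>j. decides (space X) \<Phi> (B j))"
    if B: "\<And>j. \<exists>\<Phi>. good \<Phi> \<and> decides (space X) \<Phi> (B j)" for B :: "nat \<Rightarrow> 'a set"
  proof -
    obtain \<Phi> where \<Phi>: "\<And>j. good (\<Phi> j)" "\<And>j. decides (space X) (\<Phi> j) (B j)" using B by metis
    obtain \<Psi> where "closed_code (space X) \<Psi>" "\<And>j B. decides (space X) (\<Phi> j) B \<Longrightarrow> decides (space X) \<Psi> B"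
      using closed_code_join[of "space X" \<Phi> U] \<Phi> sep unfolding good_def by metis
    then show ?thesis using \<Phi> unfolding good_def by blast
  qed
  have un: "\<exists>\<Phi>. good \<Phi> \<and> decides (space X) \<Phi> (\<Union>j. B j)"
    if B: "\<And>j::nat. \<exists>\<Phi>. good \<Phi> \<and> decides (space X) \<Phi> (B j)" for B
  proof -
    obtain \<Phi> where \<Phi>: "good \<Phi>" "\<And>j. decides (space X) \<Phi> (B j)" using join[of B, OF B] by blast
    obtain \<Psi> where "closed_code (space X) \<Psi>" "decides (space X) \<Psi> (\<Union>j. B j)"
       "\<And>C. decides (space X) \<Phi> C \<Longrightarrow> decides (space X) \<Psi> C"
      using closed_code_Union[of "space X" \<Phi> B] \<Phi> unfolding good_def by metis
    then show ?thesis using \<Phi> unfolding good_def by blast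
  qed
  have all: "\<exists>\<Phi>. good \<Phi> \<and> decides (space X) \<Phi> B" if "B \<in> sets X" for B
    using that unfolding T(3)
  proof (induction rule: sigma_sets.induct)
    case (Basic W)
    \<comment> \<open>An open set is the union of the basic sets inside it. The remaining indices
      give the empty set, which every code decides.\<close>
    define B where "B = (\<lambda>m. if U m \<subseteq> W then U m else {})"
    have "decides (space X) \<Phi>0 (B j)" for j
      using good0 unfolding B_def good_def by (auto simp: decides_def)
    then have "\<exists>\<Phi>. good \<Phi> \<and> decides (space X) \<Phi> (\<Union>j. B j)" using un[of B] good0 by blast
    moreover have "(\<Union>j. B j) = W"
    proof
      show "W \<subseteq> (\<Union>j. B j)"
      proof
        fix x assume "x \<in> W"
        then obtain m where "x \<in> U m" "U m \<subseteq> W" using 0(4)[of W x] Basic by auto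
        then have "x \<in> B m" unfolding B_def by simp
        then show "x \<in> (\<Union>j. B j)" by blast
      qed
    qed (auto simp: B_def split: if_splits)
    ultimately show ?case by simp
  next
    case Empty
    then show ?case using good0 by (auto simp: decides_def)
  next
    case (Compl a)
    then show ?case using decides_Compl by blast
  next
    case (Union a)
    then show ?case using un[of a] by blast
  qed
  have "\<exists>\<Phi>. closed_code (space X) \<Phi> \<and> (\<forall>j. decides (space X) \<Phi> (B j))" if "range B \<subseteq> sets X" for B :: "nat \<Rightarrow> 'a set"
  proof -
    have "\<exists>\<Phi>. good \<Phi> \<and> decides (space X) \<Phi> (B j)" for j using all that by blast
    from join[of B, OF this] show ?thesis unfolding good_def by blast
  qed
  with US sep that show ?thesis by blast
qed

section \<open>Images under bounded-to-one Borel maps\<close>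

text \<open>An infinite branch through a tree without leaves, presented as a function whose initial
  segments are the nodes. It serves both for inseparable prefixes and for Koenig's lemma.\<close>

lemma map_upt_of_dependent_choice:
  assumes 0: "P []" and step: "\<And>s. P s \<Longrightarrow> \<exists>a. P (s @ [a])"
  obtains z where "\<And>n. P (map z [0..<n])"
proof -
  have "\<exists>f. \<forall>n. (length (f n) = n \<and> P (f n)) \<and> (\<exists>a. f (Suc n) = f n @ [a])"
    by (rule dependent_nat_choice) (use 0 step in force)+
  then obtain f where f: "\<And>n. length (f n) = n" "\<And>n. P (f n)" "\<And>n. \<exists>a. f (Suc n) = f n @ [a]"
    by blast
  then obtain z where z: "\<And>n. f (Suc n) = f n @ [z n]" by metis
  have "f n = map z [0..<n]" for n by (induction n) (use f z in auto)
  with f(2) that show ?thesis by metis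
qed

lemma Collect_mem_sets:
  assumes "A \<in> sets X"
  shows "{x \<in> space X. x \<in> A} \<in> sets X"
proof -
  have "{x \<in> space X. x \<in> A} = A" using sets.sets_into_space[OF assms] by blast
  then show ?thesis using assms by simp
qed

text \<open>If the images were not separable, they could be shrunk coordinatewise, preserving inseparability, to images
  of single points, at least two of which differ. The letters of the lists below are \<open>(k + 1)\<close>-tuples of next coordinates.\<close>

lemma novikov_separation:
  fixes D :: "nat \<Rightarrow> 'a set"
  assumes U: "\<And>m::nat. U m \<in> sets X"
    and sep: "\<And>x y. x \<in> space X \<Longrightarrow> y \<in> space X \<Longrightarrow> (\<And>m. x \<in> U m \<longleftrightarrow> y \<in> U m) \<Longrightarrow> x = y"
    and cl: "closed_code (space X) \<Phi>"
    and g: "\<And>x. x \<in> space X \<Longrightarrow> g x \<in> space X"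
    and decU: "\<And>m. decides (space X) \<Phi> (g -` U m)"
    and decD: "\<And>j. j \<le> k \<Longrightarrow> decides (space X) \<Phi> (D j)"
    and DS: "\<And>j. j \<le> k \<Longrightarrow> D j \<subseteq> space X"
    and disj: "(\<Inter>j\<in>{..k}. g ` D j) = {}"
  obtains B where "\<And>j. j \<le> k \<Longrightarrow> B j \<in> sets X" "\<And>j. j \<le> k \<Longrightarrow> g ` D j \<subseteq> B j" "(\<Inter>j\<in>{..k}. B j) = {}"
proof -
  define piece where "piece = (\<lambda>j ts. {x\<in>D j. \<forall>i<length ts. \<Phi> x i = (ts ! i) ! j})"
  define sepr where "sepr = (\<lambda>ts. \<exists>B. (\<forall>j\<le>k. B j \<in> sets X \<and> g ` piece j ts \<subseteq> B j) \<and> (\<Inter>j\<in>{..k}. B j) = {})"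
  have step: "sepr ts" if all: "\<And>l. length l = Suc k \<Longrightarrow> sepr (ts @ [l])" for ts
  proof -
    have "\<forall>l. \<exists>B. length l = Suc k \<longrightarrow> (\<forall>j\<le>k. B j \<in> sets X \<and> g ` piece j (ts @ [l]) \<subseteq> B j) \<and> (\<Inter>j\<in>{..k}. B j) = {}"
    proof
      fix l :: "nat list"
      show "\<exists>B. length l = Suc k \<longrightarrow> (\<forall>j\<le>k. B j \<in> sets X \<and> g ` piece j (ts @ [l]) \<subseteq> B j) \<and> (\<Inter>j\<in>{..k}. B j) = {}"
        by (cases "length l = Suc k") (use all[of l, unfolded sepr_def] in simp_all)
    qed
    then obtain Bf where Bf: "\<And>l j. length l = Suc k \<Longrightarrow> j \<le> k \<Longrightarrow> Bf l j \<in> sets X"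
       "\<And>l j. length l = Suc k \<Longrightarrow> j \<le> k \<Longrightarrow> g ` piece j (ts @ [l]) \<subseteq> Bf l j"
       "\<And>l. length l = Suc k \<Longrightarrow> (\<Inter>j\<in>{..k}. Bf l j) = {}"
      by metis
    \<comment> \<open>A point in every \<open>B j\<close> selects a value \<open>n j\<close> for
      each \<open>j\<close>. The letter with these entries puts the point into all hulls of one
      separated family, which is impossible.\<close>
    define B where "B = (\<lambda>j. \<Union>n. \<Inter>l\<in>{l. length l = Suc k \<and> l ! j = n}. Bf l j)"
    have "B j \<in> sets X" if "j \<le> k" for j
    proof -
      have "(\<Inter>l\<in>{l. length l = Suc k \<and> l ! j = n}. Bf l j) \<in> sets X" for n
      proof (rule sets.countable_INT')
        \<comment> \<open>The index set has to be nonempty, since an empty intersection would be the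
          whole type.\<close>
        have "replicate (Suc k) n \<in> {l. length l = Suc k \<and> l ! j = n}" using that
          by (simp add: nth_replicate del: replicate_Suc)
        then show "{l. length l = Suc k \<and> l ! j = n} \<noteq> {}" by blast
      qed (use Bf(1) that in auto)
      then show ?thesis unfolding B_def by blast
    qed
    moreover have "g ` piece j ts \<subseteq> B j" if "j \<le> k" for j
    proof
      fix y assume "y \<in> g ` piece j ts"
      then obtain x where x: "x \<in> piece j ts" "y = g x" by blast
      have "y \<in> Bf l j" if "length l = Suc k" "l ! j = \<Phi> x (length ts)" for l
      proof -
        have "x \<in> piece j (ts @ [l])"
          using x(1) that unfolding piece_def by (auto simp: nth_append less_Suc_eq)
        then show ?thesis using Bf(2)[OF that(1) \<open>j \<le> k\<close>] x by blast
      qed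
      then show "y \<in> B j" unfolding B_def by blast
    qed
    moreover have "(\<Inter>j\<in>{..k}. B j) = {}"
    proof (rule ccontr)
      assume "(\<Inter>j\<in>{..k}. B j) \<noteq> {}"
      then obtain y where y: "\<And>j. j \<le> k \<Longrightarrow> y \<in> B j" by blast
      then have "\<forall>j. \<exists>n. j \<le> k \<longrightarrow> (\<forall>l. length l = Suc k \<and> l ! j = n \<longrightarrow> y \<in> Bf l j)"
        unfolding B_def by blast
      then obtain n where n: "\<And>j l. j \<le> k \<Longrightarrow> length l = Suc k \<Longrightarrow> l ! j = n j \<Longrightarrow> y \<in> Bf l j" by metis
      have "y \<in> Bf (map n [0..<Suc k]) j" if "j \<le> k" for j
        by (rule n[OF that]) (use that in \<open>auto simp del: upt_Suc\<close>)
      then show False using Bf(3)[of "map n [0..<Suc k]"] by auto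
    qed
    ultimately show ?thesis unfolding sepr_def by blast
  qed
  have "sepr []"
  proof (rule ccontr)
    assume not: "\<not> sepr []"
    obtain L where L: "\<And>n. \<not> sepr (map L [0..<n])"
      using map_upt_of_dependent_choice[of "\<lambda>s. \<not> sepr s"] not step by metis
    define z where "z = (\<lambda>j i. L i ! j)"
    have pc: "piece j (map L [0..<n]) = {x\<in>D j. \<forall>i<n. \<Phi> x i = z j i}" for j n
      unfolding piece_def z_def by auto
    \<comment> \<open>An empty piece has the empty hull and the whole space serves for the others,
      so inseparable prefixes have no empty piece.\<close>
    have ne: "\<exists>x\<in>D j. \<forall>i<n. \<Phi> x i = z j i" if "j \<le> k" for j n
    proof (rule ccontr)
      assume "\<not> ?thesis"
      then have e: "piece j (map L [0..<n]) = {}" using pc by auto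
      have "sepr (map L [0..<n])"
        unfolding sepr_def
      proof (intro exI[of _ "\<lambda>i. if i = j then {} else space X"] conjI allI impI)
        fix i assume i: "i \<le> k"
        show "(if i = j then {} else space X) \<in> sets X" by auto
        show "g ` piece i (map L [0..<n]) \<subseteq> (if i = j then {} else space X)"
          using e g DS[OF i] unfolding pc by (auto split: if_splits)
      qed (use that in auto)
      then show False using L by blast
    qed
    \<comment> \<open>The closed code gives a limit in the whole space; it lies in
      \<open>D j\<close> because a finite prefix decides \<open>D j\<close>.\<close>
    have "\<exists>x\<in>D j. \<Phi> x = z j" if j: "j \<le> k" for j
    proof -
      obtain x where x: "x \<in> space X" "\<Phi> x = z j"
        using closed_codeD[OF cl, of "z j"] ne[OF j] DS[OF j] by blast
      obtain n where n: "\<And>x y. x\<in>space X \<Longrightarrow> y\<in>space X \<Longrightarrow> (\<forall>i<n. \<Phi> x i = \<Phi> y i) \<Longrightarrow> (x \<in> D j \<longleftrightarrow> y \<in> D j)"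
        using decD[OF j] unfolding decides_def by blast
      obtain y where y: "y \<in> D j" "\<forall>i<n. \<Phi> y i = z j i" using ne[OF j] by blast
      then have "x \<in> D j" using n[of x y] x DS[OF j] by auto
      then show ?thesis using x by blast
    qed
    then obtain x where x: "\<And>j. j \<le> k \<Longrightarrow> x j \<in> D j" "\<And>j. j \<le> k \<Longrightarrow> \<Phi> (x j) = z j" by metis
    have "\<exists>j\<le>k. g (x j) \<noteq> g (x 0)"
    proof (rule ccontr)
      assume "\<not> ?thesis"
      then have "g (x j) = g (x 0)" if "j \<le> k" for j using that by blast
      then have "g (x 0) \<in> g ` D j" if "j \<le> k" for j using x(1) that by (metis imageI)
      then have "g (x 0) \<in> (\<Inter>j\<in>{..k}. g ` D j)" by blast
      then show False unfolding disj by (rule emptyE)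
    qed
    then obtain j where j: "j \<le> k" "g (x j) \<noteq> g (x 0)" by blast
    have xS: "x j \<in> space X" "x 0 \<in> space X" using x(1) DS j by blast+
    obtain m where m: "\<not> (g (x j) \<in> U m \<longleftrightarrow> g (x 0) \<in> U m)"
      using sep[OF g[OF xS(1)] g[OF xS(2)]] j(2) by auto
    \<comment> \<open>\<open>W i\<close> is the side of \<open>U m\<close> on which
      \<open>g (x i)\<close> lies. A long prefix forces the image of the piece onto that side, so
      \<open>W 0\<close> and \<open>W j\<close>, with the whole space elsewhere, separate a prefix
      chosen to be inseparable.\<close>
    define W where "W = (\<lambda>i. {y\<in>space X. y \<in> U m \<longleftrightarrow> g (x i) \<in> U m})"
    have WB: "W i \<in> sets X" for i
    proof -
      have "W i = (if g (x i) \<in> U m then U m else space X - U m)"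
        unfolding W_def using sets.sets_into_space[OF U[of m]] by auto
      then show ?thesis using U[of m] by auto
    qed
    obtain n where n: "\<And>x y. x\<in>space X \<Longrightarrow> y\<in>space X \<Longrightarrow> (\<forall>i<n. \<Phi> x i = \<Phi> y i) \<Longrightarrow> (g x \<in> U m \<longleftrightarrow> g y \<in> U m)"
      using decU[of m] unfolding decides_def by auto
    have gW: "g ` piece i (map L [0..<n]) \<subseteq> W i" if i: "i \<le> k" for i
    proof
      fix y assume "y \<in> g ` piece i (map L [0..<n])"
      then obtain x' where x': "x' \<in> D i" "\<forall>q<n. \<Phi> x' q = z i q" "y = g x'" unfolding pc by blast
      have S: "x' \<in> space X" "x i \<in> space X" using x'(1) x(1)[OF i] DS[OF i] by blast+
      have "g x' \<in> U m \<longleftrightarrow> g (x i) \<in> U m"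
        by (rule n[OF S]) (simp add: x'(2) x(2)[OF i])
      then show "y \<in> W i" unfolding W_def x'(3) using g[OF S(1)] by simp
    qed
    have "sepr (map L [0..<n])"
      unfolding sepr_def
    proof (intro exI[of _ "\<lambda>i. if i = 0 \<or> i = j then W i else space X"] conjI allI impI)
      fix i assume i: "i \<le> k"
      show "(if i = 0 \<or> i = j then W i else space X) \<in> sets X" using WB by auto
      show "g ` piece i (map L [0..<n]) \<subseteq> (if i = 0 \<or> i = j then W i else space X)"
        using gW[OF i] unfolding W_def by auto
    next
      have "W 0 \<inter> W j = {}" using m unfolding W_def by auto
      moreover have "(\<Inter>i\<in>{..k}. if i = 0 \<or> i = j then W i else space X) \<subseteq> W 0 \<inter> W j"
      proof
        fix y assume "y \<in> (\<Inter>i\<in>{..k}. if i = 0 \<or> i = j then W i else space X)"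
        then have "\<And>i. i \<le> k \<Longrightarrow> y \<in> (if i = 0 \<or> i = j then W i else space X)" by blast
        from this[of 0] this[of j] j(1) show "y \<in> W 0 \<inter> W j" by simp
      qed
      ultimately show "(\<Inter>i\<in>{..k}. if i = 0 \<or> i = j then W i else space X) = {}" by blast
    qed
    then show False using L by blast
  qed
  then obtain B where B: "\<And>j. j \<le> k \<Longrightarrow> B j \<in> sets X \<and> g ` piece j [] \<subseteq> B j" "(\<Inter>j\<in>{..k}. B j) = {}"
    unfolding sepr_def by blast
  moreover have "piece j [] = D j" for j unfolding piece_def by simp
  ultimately show ?thesis using that by metis
qed

text \<open>\<open>C s\<close> is a Borel hull of the image of the piece of \<open>A\<close> with code prefix \<open>s\<close>, such that a point lies in
  at most \<open>k\<close> hulls of each level. By Koenig's lemma a point in hulls of all levels lies on a branch.\<close>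

lemma sets_image_bounded_to_one:
  assumes X: "standard_borel_space X" and g: "g \<in> measurable X X" and A: "A \<in> sets X"
    and k: "\<And>y. y \<in> space X \<Longrightarrow> finite {x\<in>A. g x = y} \<and> card {x\<in>A. g x = y} \<le> k"
  shows "g ` A \<in> sets X"
proof -
  obtain U :: "nat \<Rightarrow> 'a set" where U: "\<And>m. U m \<in> sets X"
    and sep: "\<And>x y. x \<in> space X \<Longrightarrow> y \<in> space X \<Longrightarrow> (\<And>m. x \<in> U m \<longleftrightarrow> y \<in> U m) \<Longrightarrow> x = y"
    and code: "\<And>B. range B \<subseteq> sets X \<Longrightarrow> \<exists>\<Phi>. closed_code (space X) \<Phi> \<and> (\<forall>j::nat. decides (space X) \<Phi> (B j))"
    using standard_borel_coding[OF X] by blast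
  define S where "S = space X"
  have AS: "A \<subseteq> S" using sets.sets_into_space[OF A] S_def by simp
  have gS: "g x \<in> S" if "x \<in> S" for x using measurable_space[OF g] that S_def by simp
  obtain \<Phi> where cl: "closed_code S \<Phi>" and decA: "decides S \<Phi> A"
    and decU: "\<And>m. decides S \<Phi> (g -` U m)"
  proof -
    let ?B = "\<lambda>j. case j of 0 \<Rightarrow> A | Suc m \<Rightarrow> g -` U m \<inter> space X"
    have "range ?B \<subseteq> sets X" using A measurable_sets[OF g U] by (auto split: nat.splits)
    then obtain \<Phi> where \<Phi>: "closed_code S \<Phi>" "\<And>j. decides S \<Phi> (?B j)"
      using code[of ?B] S_def by metis
    show ?thesis
    proof (rule that[OF \<Phi>(1)])
      show "decides S \<Phi> A" using \<Phi>(2)[of 0] by simp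
      show "decides S \<Phi> (g -` U m)" for m
        using \<Phi>(2)[of "Suc m"] unfolding decides_def S_def by auto
    qed
  qed
  define piece where "piece = (\<lambda>s. {x\<in>A. \<forall>i<length s. \<Phi> x i = s ! i})"
  \<comment> \<open>Different prefixes of one length have disjoint pieces. A common point of the
    \<open>k + 1\<close> images would have \<open>k + 1\<close> preimages, so the images can be
    separated.\<close>
  define valid where "valid = (\<lambda>ss :: nat list list. length ss = Suc k \<and> distinct ss \<and> (\<exists>n. \<forall>s\<in>set ss. length s = n))"
  have "\<exists>B. (\<forall>j\<le>k. B j \<in> sets X \<and> g ` piece (ss ! j) \<subseteq> B j) \<and> (\<Inter>j\<in>{..k}. B j) = {}" if v: "valid ss" for ss
  proof -
    have len: "length ss = Suc k" and dist: "distinct ss" using v valid_def by auto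
    obtain n where n: "\<And>j. j \<le> k \<Longrightarrow> length (ss ! j) = n" using v len unfolding valid_def
      by (metis le_imp_less_Suc nth_mem)
    have decp: "decides S \<Phi> (piece (ss ! j))" for j
    proof -
      obtain n' where n': "\<And>x y. x\<in>S \<Longrightarrow> y\<in>S \<Longrightarrow> (\<forall>i<n'. \<Phi> x i = \<Phi> y i) \<Longrightarrow> (x \<in> A \<longleftrightarrow> y \<in> A)"
        using decA unfolding decides_def by blast
      show ?thesis unfolding decides_def
      proof (intro exI[of _ "max n' (length (ss ! j))"] ballI impI)
        fix x y assume *: "x \<in> S" "y \<in> S" "\<forall>i<max n' (length (ss ! j)). \<Phi> x i = \<Phi> y i"
        then have "x \<in> A \<longleftrightarrow> y \<in> A" using n'[of x y] by simp
        then show "x \<in> piece (ss ! j) \<longleftrightarrow> y \<in> piece (ss ! j)" using * unfolding piece_def by simp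
      qed
    qed
    have "(\<Inter>j\<in>{..k}. g ` piece (ss ! j)) = {}"
    proof (rule ccontr)
      assume "\<not> ?thesis"
      then obtain y where "\<And>j. j \<le> k \<Longrightarrow> y \<in> g ` piece (ss ! j)" by blast
      then have "\<forall>j. \<exists>x. j \<le> k \<longrightarrow> x \<in> piece (ss ! j) \<and> y = g x" by blast
      then obtain x where x: "\<And>j. j \<le> k \<Longrightarrow> x j \<in> piece (ss ! j)" "\<And>j. j \<le> k \<Longrightarrow> y = g (x j)" by metis
      have inj: "inj_on x {..k}"
      proof (rule inj_onI)
        fix i j assume ij: "i \<in> {..k}" "j \<in> {..k}" "x i = x j"
        have "ss ! i = ss ! j"
        proof (rule nth_equalityI)
          show "length (ss ! i) = length (ss ! j)" using n ij by auto
          fix q assume q: "q < length (ss ! i)"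
          then have "\<Phi> (x i) q = ss ! i ! q" "\<Phi> (x j) q = ss ! j ! q"
            using x(1)[of i] x(1)[of j] ij n unfolding piece_def by auto
          then show "ss ! i ! q = ss ! j ! q" using ij by simp
        qed
        then show "i = j" using dist len ij by (simp add: nth_eq_iff_index_eq)
      qed
      have "y \<in> space X" using x(1)[of 0] x(2)[of 0] AS gS unfolding piece_def S_def by auto
      then have "finite {x\<in>A. g x = y}" "card {x\<in>A. g x = y} \<le> k" using k by auto
      moreover have "x ` {..k} \<subseteq> {x\<in>A. g x = y}"
        using x unfolding piece_def by auto
      ultimately have "card (x ` {..k}) \<le> k" using card_mono order_trans by blast
      then show False using card_image[OF inj] by simp
    qed
    note pdisj = this
    show ?thesis
    proof (rule novikov_separation[of U X \<Phi> g k "\<lambda>j. piece (ss ! j)", OF U sep cl[unfolded S_def] gS[unfolded S_def]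
          decU[unfolded S_def] decp[unfolded S_def] _ pdisj])
      show "piece (ss ! j) \<subseteq> space X" for j using AS unfolding piece_def S_def by blast
    next
      fix B assume "\<And>j. j \<le> k \<Longrightarrow> B j \<in> sets X" "\<And>j. j \<le> k \<Longrightarrow> g ` piece (ss ! j) \<subseteq> B j" "(\<Inter>j\<in>{..k}. B j) = {}"
      then show ?thesis by (intro exI[of _ B]) simp
    qed
  qed
  then obtain Bs where Bs: "\<And>ss j. valid ss \<Longrightarrow> j \<le> k \<Longrightarrow> Bs ss j \<in> sets X"
     "\<And>ss j. valid ss \<Longrightarrow> j \<le> k \<Longrightarrow> g ` piece (ss ! j) \<subseteq> Bs ss j"
     "\<And>ss. valid ss \<Longrightarrow> (\<Inter>j\<in>{..k}. Bs ss j) = {}" by metis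
  \<comment> \<open>Besides lying in the hulls of all separations that involve \<open>s\<close>, the
    point has to be on the same side as the image for every \<open>U m\<close> that does not cut the
    image. This is what identifies it with the image of the branch at the end.\<close>
  define C0 where "C0 = (\<lambda>s. {y\<in>S. (\<forall>ss j. valid ss \<and> j \<le> k \<and> ss ! j = s \<longrightarrow> y \<in> Bs ss j)
     \<and> (\<forall>m. (g ` piece s \<subseteq> U m \<longrightarrow> y \<in> U m) \<and> (g ` piece s \<inter> U m = {} \<longrightarrow> y \<notin> U m)) \<and> piece s \<noteq> {}})"
  have C0B: "C0 s \<in> sets X" for s
  proof -
    have 1: "{y \<in> space X. valid ss \<and> j \<le> k \<and> ss ! j = s \<longrightarrow> y \<in> Bs ss j} \<in> sets X" for ss j
    proof (cases "valid ss \<and> j \<le> k \<and> ss ! j = s")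
      case True
      then show ?thesis using Collect_mem_sets[OF Bs(1)[of ss j]] by simp
    next
      case False
      then have "{y \<in> space X. valid ss \<and> j \<le> k \<and> ss ! j = s \<longrightarrow> y \<in> Bs ss j} = space X" by blast
      then show ?thesis by simp
    qed
    have 2: "{y \<in> space X. (b \<longrightarrow> y \<in> U m) \<and> (c \<longrightarrow> y \<notin> U m)} \<in> sets X" for b c m
      by (intro sets.sets_Collect_conj sets.sets_Collect_imp sets.sets_Collect_neg sets.sets_Collect_const Collect_mem_sets U)
    show ?thesis unfolding C0_def S_def
      by (intro sets.sets_Collect_conj sets.sets_Collect_countable_All sets.sets_Collect_const 1 2)
  qed
  have gC0: "g x \<in> C0 s" if "x \<in> piece s" for x s
    using that Bs(2) gS AS unfolding C0_def by (auto simp: piece_def)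
  \<comment> \<open>Taking all prefixes into account makes the hulls decrease along extensions, so
    that the nodes whose hull contains a given point form a tree.\<close>
  define C where "C = (\<lambda>s. {y\<in>S. \<forall>i. y \<in> C0 (take i s)})"
  have CB: "C s \<in> sets X" for s
  proof -
    show ?thesis unfolding C_def S_def
      by (intro sets.sets_Collect_countable_All Collect_mem_sets C0B)
  qed
  have Ctake: "y \<in> C (take i s)" if "y \<in> C s" for y i s
    using that unfolding C_def by (auto simp: min_def)
  have CC0: "y \<in> C0 s" if "y \<in> C s" for y s
    using that unfolding C_def by (auto dest: spec[of _ "length s"])
  have few: "finite {s. length s = n \<and> y \<in> C s}" for n y
  proof (rule ccontr)
    assume inf: "infinite {s. length s = n \<and> y \<in> C s}"
    obtain T where T: "T \<subseteq> {s. length s = n \<and> y \<in> C s}" "card T = Suc k" "finite T"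
      using infinite_arbitrarily_large[OF inf] by blast
    obtain ss where ss: "set ss = T" "distinct ss" using finite_distinct_list[OF T(3)] by blast
    have len: "length ss = Suc k" using ss T(2) distinct_card by metis
    then have v: "valid ss" using ss T unfolding valid_def by blast
    have "y \<in> Bs ss j" if "j \<le> k" for j
    proof -
      have "ss ! j \<in> T" using ss len that by (metis le_imp_less_Suc nth_mem)
      then have "y \<in> C0 (ss ! j)" using T CC0 by blast
      then show ?thesis using v that unfolding C0_def by blast
    qed
    then show False using Bs(3)[OF v] by auto
  qed
  have "g ` A = {y\<in>S. \<forall>n. \<exists>s. length s = n \<and> y \<in> C s}"
  proof (intro equalityI subsetI)
    fix y assume "y \<in> g ` A"
    then obtain x where x: "x \<in> A" "y = g x" by blast
    have "g x \<in> C (map (\<Phi> x) [0..<n])" for n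
    proof -
      have "x \<in> piece (take i (map (\<Phi> x) [0..<n]))" for i using x(1) unfolding piece_def by simp
      then show ?thesis unfolding C_def using gC0 gS AS x(1) by blast
    qed
    then have "\<exists>s. length s = n \<and> y \<in> C s" for n
      using x(2) by (intro exI[of _ "map (\<Phi> x) [0..<n]"]) simp
    moreover have "y \<in> S" using x AS gS by blast
    ultimately show "y \<in> {y\<in>S. \<forall>n. \<exists>s. length s = n \<and> y \<in> C s}" by simp
  next
    fix y assume "y \<in> {y\<in>S. \<forall>n. \<exists>s. length s = n \<and> y \<in> C s}"
    then have yS: "y \<in> S" and y: "\<And>n. \<exists>s. length s = n \<and> y \<in> C s" by simp_all
    \<comment> \<open>Nodes with descendants of every length. By \<open>few\<close>, a node has only
      finitely many children in the tree, so one bound covers the lengths at which its children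
      would die out.\<close>
    define big where "big = (\<lambda>s. \<forall>n\<ge>length s. \<exists>t. length t = n \<and> take (length s) t = s \<and> y \<in> C t)"
    have big0: "big []" unfolding big_def using y by simp
    have bigS: "\<exists>a. big (s @ [a])" if s: "big s" for s
    proof (rule ccontr)
      assume no: "\<nexists>a. big (s @ [a])"
      let ?K = "{t. length t = Suc (length s) \<and> y \<in> C t}"
      have "\<exists>n\<ge>Suc (length s). \<forall>t. length t = n \<longrightarrow> take (Suc (length s)) t = s @ [a] \<longrightarrow> y \<notin> C t" for a
        using no unfolding big_def length_append_singleton by blast
      then obtain m where m: "\<And>a. Suc (length s) \<le> m a"
          "\<And>a t. length t = m a \<Longrightarrow> take (Suc (length s)) t = s @ [a] \<Longrightarrow> y \<notin> C t"
        by metis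
      \<comment> \<open>At length \<open>N\<close> no child would have a descendant left, yet
        \<open>t\<close> is at least that long and passes through a child.\<close>
      define N where "N = Max (m ` {a. s @ [a] \<in> ?K})"
      have fin: "finite {a. s @ [a] \<in> ?K}"
      proof (rule finite_imageD)
        show "finite ((\<lambda>a. s @ [a]) ` {a. s @ [a] \<in> ?K})"
          by (rule finite_subset[OF _ few[of "Suc (length s)" y]]) blast
      qed (simp add: inj_on_def)
      obtain t where t: "length t = max N (Suc (length s))" "take (length s) t = s" "y \<in> C t"
        using s unfolding big_def by (meson le_SucI max.coboundedI2 order_refl)
      let ?a = "t ! length s"
      have eq: "take (Suc (length s)) t = s @ [?a]"
        using t by (simp add: take_Suc_conv_app_nth)
      then have "s @ [?a] \<in> ?K" using Ctake[OF t(3), of "Suc (length s)"] by simp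
      then have "m ?a \<le> N" unfolding N_def using fin by (intro Max_ge) auto
      then have "length (take (m ?a) t) = m ?a" using t(1) by simp
      moreover have "take (Suc (length s)) (take (m ?a) t) = s @ [?a]" using eq m(1)[of ?a] by (simp add: min_def)
      ultimately show False using m(2) Ctake[OF t(3)] by blast
    qed
    obtain z where z: "\<And>n. big (map z [0..<n])"
      using map_upt_of_dependent_choice[of big] big0 bigS by metis
    have yC: "y \<in> C0 (map z [0..<n])" for n
      using z[of n] CC0 unfolding big_def by (metis order_refl take_all_iff)
    have pz: "piece (map z [0..<n]) = {x\<in>A. \<forall>i<n. \<Phi> x i = z i}" for n
      unfolding piece_def by auto
    have ne: "\<exists>x\<in>A. \<forall>i<n. \<Phi> x i = z i" for n using yC[of n] unfolding C0_def pz by blast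
    obtain x where x: "x \<in> S" "\<Phi> x = z" using closed_codeD[OF cl, of z] ne AS by blast
    have xA: "x \<in> A"
    proof -
      obtain n where n: "\<And>x y. x\<in>S \<Longrightarrow> y\<in>S \<Longrightarrow> (\<forall>i<n. \<Phi> x i = \<Phi> y i) \<Longrightarrow> (x \<in> A \<longleftrightarrow> y \<in> A)"
        using decA unfolding decides_def by blast
      obtain x' where "x' \<in> A" "\<forall>i<n. \<Phi> x' i = z i" using ne by blast
      then show ?thesis using n[of x x'] x AS by auto
    qed
    have "g x = y"
    proof (rule sep)
      fix m
      obtain n where n: "\<And>x y. x\<in>S \<Longrightarrow> y\<in>S \<Longrightarrow> (\<forall>i<n. \<Phi> x i = \<Phi> y i) \<Longrightarrow> (g x \<in> U m \<longleftrightarrow> g y \<in> U m)"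
        using decU[of m] unfolding decides_def by auto
      have "\<forall>x'\<in>piece (map z [0..<n]). g x' \<in> U m \<longleftrightarrow> g x \<in> U m"
      proof
        fix x' assume "x' \<in> piece (map z [0..<n])"
        then have x': "x' \<in> S" "\<forall>i<n. \<Phi> x' i = z i" using AS unfolding pz by auto
        show "g x' \<in> U m \<longleftrightarrow> g x \<in> U m" by (rule n[OF x'(1) x(1)]) (simp add: x'(2) x(2))
      qed
      then show "g x \<in> U m \<longleftrightarrow> y \<in> U m" using yC[of n] unfolding C0_def by blast
    qed (use x yS gS S_def in auto)
    then show "y \<in> g ` A" using xA by blast
  qed
  moreover have "{y\<in>S. \<forall>n. \<exists>s. length s = n \<and> y \<in> C s} \<in> sets X"
    unfolding S_def
    by (intro sets.sets_Collect_countable_All sets.sets_Collect_countable_Ex sets.sets_Collect_conj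
        sets.sets_Collect_const Collect_mem_sets CB)
  ultimately show ?thesis by (simp only:)
qed

section \<open>Borel colourings of bounded degree graphs\<close>

text \<open>The finitely many neighbours are cut off from \<open>p\<close> by finitely many
  separating sets, so one of the countably many finite Boolean conditions holds at \<open>p\<close>
  and at no neighbour. The least one is the colour; a neighbour of the same colour would satisfy
  it.\<close>

lemma countable_borel_colouring:
  fixes U :: "nat \<Rightarrow> 'a set"
  assumes U: "\<And>m. U m \<in> sets X"
    and sep: "\<And>x y. x \<in> space X \<Longrightarrow> y \<in> space X \<Longrightarrow> (\<And>m. x \<in> U m \<longleftrightarrow> y \<in> U m) \<Longrightarrow> x = y"
    and nbS: "\<And>p. p \<in> space X \<Longrightarrow> nb p \<subseteq> space X"
    and fin: "\<And>p. p \<in> space X \<Longrightarrow> finite (nb p)"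
    and irr: "\<And>p. p \<in> space X \<Longrightarrow> p \<notin> nb p"
    and meas: "\<And>B. B \<in> sets X \<Longrightarrow> {p\<in>space X. nb p \<inter> B \<noteq> {}} \<in> sets X"
  shows "\<exists>\<kappa> :: 'a \<Rightarrow> nat. \<kappa> \<in> measurable X (count_space UNIV) \<and> (\<forall>p\<in>space X. \<forall>q\<in>nb p. \<kappa> p \<noteq> \<kappa> q)"
proof -
  define V where "V = (\<lambda>n. {p\<in>space X. \<forall>(m, b)\<in>set (from_nat n :: (nat \<times> bool) list). p \<in> U m \<longleftrightarrow> b})"
  have VB: "V n \<in> sets X" for n
  proof -
    have "{p\<in>space X. p \<in> U m \<longleftrightarrow> b} \<in> sets X" for m b
      by (cases b) (auto intro!: Collect_mem_sets[OF U] sets.sets_Collect_neg)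
    then have "{p\<in>space X. \<forall>mb\<in>set (from_nat n :: (nat \<times> bool) list). p \<in> U (fst mb) \<longleftrightarrow> snd mb} \<in> sets X"
      by (intro sets.sets_Collect_finite_All) auto
    then show ?thesis unfolding V_def by (simp add: case_prod_beta)
  qed
  have ex: "\<exists>n. p \<in> V n \<and> nb p \<inter> V n = {}" if p: "p \<in> space X" for p
  proof -
    have "\<exists>m. \<not> (p \<in> U m \<longleftrightarrow> q \<in> U m)" if q: "q \<in> nb p" for q
    proof (rule ccontr)
      assume "\<not> ?thesis"
      then have "p = q" using sep[OF p, of q] nbS[OF p] q by blast
      then show False using irr[OF p] q by blast
    qed
    then obtain m where m: "\<And>q. q \<in> nb p \<Longrightarrow> \<not> (p \<in> U (m q) \<longleftrightarrow> q \<in> U (m q))" by metis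
    obtain l where l: "set l = nb p" using finite_list[OF fin[OF p]] by blast
    define n where "n = to_nat (map (\<lambda>q. (m q, p \<in> U (m q))) l)"
    have "V n = {x\<in>space X. \<forall>q\<in>nb p. x \<in> U (m q) \<longleftrightarrow> p \<in> U (m q)}"
      unfolding V_def n_def by (auto simp: l)
    then have "p \<in> V n \<and> nb p \<inter> V n = {}" using p m by blast
    then show ?thesis by blast
  qed
  define \<kappa> where "\<kappa> = (\<lambda>p. LEAST n. p \<in> V n \<and> nb p \<inter> V n = {})"
  have "{p\<in>space X. p \<in> V n \<and> nb p \<inter> V n = {}} \<in> sets X" for n
    using sets.sets_Collect_neg[OF meas[OF VB[of n]]] Collect_mem_sets[OF VB[of n]]
    by (intro sets.sets_Collect_conj) simp_all
  then have "\<kappa> \<in> measurable X (count_space UNIV)"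
    unfolding \<kappa>_def by (intro measurable_Least) (simp add: pred_def)
  moreover have "\<kappa> p \<noteq> \<kappa> q" if p: "p \<in> space X" and q: "q \<in> nb p" for p q
  proof
    assume eq: "\<kappa> p = \<kappa> q"
    have "q \<in> space X" using nbS[OF p] q by blast
    then have "q \<in> V (\<kappa> q)" using LeastI_ex[OF ex, of q] unfolding \<kappa>_def by blast
    moreover have "nb p \<inter> V (\<kappa> p) = {}" using LeastI_ex[OF ex[OF p]] unfolding \<kappa>_def by blast
    ultimately show False using eq q by auto
  qed
  ultimately show ?thesis by blast
qed

text \<open>Classes of the countable colouring contain no adjacent points, so they can be treated
  one after another, each point taking the least colour absent from its neighbours treated before.
  With at most \<open>D\<close> neighbours, one of the \<open>D + 1\<close> colours is free.\<close>

lemma finite_borel_colouring: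
  fixes U :: "nat \<Rightarrow> 'a set" and D :: nat
  assumes U: "\<And>m. U m \<in> sets X"
    and sep: "\<And>x y. x \<in> space X \<Longrightarrow> y \<in> space X \<Longrightarrow> (\<And>m. x \<in> U m \<longleftrightarrow> y \<in> U m) \<Longrightarrow> x = y"
    and nbS: "\<And>p. p \<in> space X \<Longrightarrow> nb p \<subseteq> space X"
    and fin: "\<And>p. p \<in> space X \<Longrightarrow> finite (nb p)"
    and deg: "\<And>p. p \<in> space X \<Longrightarrow> card (nb p) \<le> D"
    and irr: "\<And>p. p \<in> space X \<Longrightarrow> p \<notin> nb p"
    and symm: "\<And>p q. p \<in> space X \<Longrightarrow> q \<in> nb p \<Longrightarrow> p \<in> nb q"
    and meas: "\<And>B. B \<in> sets X \<Longrightarrow> {p\<in>space X. nb p \<inter> B \<noteq> {}} \<in> sets X"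
  shows "\<exists>c :: 'a \<Rightarrow> nat. c \<in> measurable X (count_space UNIV) \<and> (\<forall>p\<in>space X. c p \<le> D)
    \<and> (\<forall>p\<in>space X. \<forall>q\<in>nb p. c p \<noteq> c q)"
proof -
  have "\<exists>\<kappa> :: 'a \<Rightarrow> nat. \<kappa> \<in> measurable X (count_space UNIV) \<and> (\<forall>p\<in>space X. \<forall>q\<in>nb p. \<kappa> p \<noteq> \<kappa> q)"
    by (rule countable_borel_colouring[of U X nb]) (fact U sep nbS fin irr meas)+
  then obtain \<kappa> :: "'a \<Rightarrow> nat" where \<kappa>: "\<kappa> \<in> measurable X (count_space UNIV)"
    "\<And>p q. p \<in> space X \<Longrightarrow> q \<in> nb p \<Longrightarrow> \<kappa> p \<noteq> \<kappa> q"
    by blast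
  \<comment> \<open>\<open>B n i\<close> collects the points with \<open>\<kappa>\<close> below
    \<open>n\<close> that have received colour \<open>i\<close>; the stage that colours
    \<open>p\<close> produces \<open>B (Suc (\<kappa> p))\<close>.\<close>
  define B where "B = rec_nat (\<lambda>i::nat. {}::'a set) (\<lambda>n Bn i. Bn i \<union>
     {p\<in>space X. \<kappa> p = n \<and> nb p \<inter> Bn i = {} \<and> (\<forall>j<i. nb p \<inter> Bn j \<noteq> {})})"
  have B0: "B 0 i = {}" for i by (simp add: B_def)
  have BS: "B (Suc n) i = B n i \<union>
     {p\<in>space X. \<kappa> p = n \<and> nb p \<inter> B n i = {} \<and> (\<forall>j<i. nb p \<inter> B n j \<noteq> {})}" for n i
    by (simp add: B_def)
  have Bm: "B n i \<in> sets X" for n i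
  proof (induction n arbitrary: i)
    case 0
    then show ?case by (simp add: B0)
  next
    case (Suc n)
    have 1: "{p\<in>space X. nb p \<inter> B n j \<noteq> {}} \<in> sets X" for j using meas Suc by blast
    have 2: "{p\<in>space X. \<kappa> p = n} \<in> sets X" using measurable_sets[OF \<kappa>(1), of "{n}"]
      by (simp add: vimage_def Int_def conj_commute)
    have 3: "{p\<in>space X. nb p \<inter> B n i = {}} \<in> sets X" using sets.sets_Collect_neg[OF 1[of i]] by (simp only: not_not)
    have 4: "{p\<in>space X. \<forall>j<i. nb p \<inter> B n j \<noteq> {}} \<in> sets X"
    proof -
      have "{p\<in>space X. \<forall>j\<in>{..<i}. nb p \<inter> B n j \<noteq> {}} \<in> sets X"
        by (intro sets.sets_Collect_finite_All 1) auto
      then show ?thesis by (simp only: Ball_def lessThan_iff)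
    qed
    show ?case unfolding BS by (intro sets.Un Suc sets.sets_Collect_conj 2 3 4)
  qed
  have Blt: "p \<in> space X \<and> \<kappa> p < n" if "p \<in> B n i" for p n i
    using that by (induction n) (auto simp: B0 BS less_Suc_eq)
  have stable: "p \<in> B n i \<longleftrightarrow> p \<in> B (Suc (\<kappa> p)) i" if "\<kappa> p < n" for p n i
    using that
  proof (induction n)
    case (Suc n)
    show ?case
    proof (cases "\<kappa> p = n")
      case False
      then have "p \<in> B (Suc n) i \<longleftrightarrow> p \<in> B n i" unfolding BS by auto
      then show ?thesis using Suc False by simp
    qed simp
  qed simp
  have new: "p \<in> B (Suc (\<kappa> p)) i \<longleftrightarrow> nb p \<inter> B (\<kappa> p) i = {} \<and> (\<forall>j<i. nb p \<inter> B (\<kappa> p) j \<noteq> {})"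
    if "p \<in> space X" for p i
    unfolding BS using that Blt[of p "\<kappa> p" i] by auto
  have uniq: "i = j" if "p \<in> B n i" "p \<in> B n j" for p n i j
  proof -
    have p: "p \<in> space X" "\<kappa> p < n" using Blt that by blast+
    have "p \<in> B (Suc (\<kappa> p)) i" "p \<in> B (Suc (\<kappa> p)) j" using stable[OF p(2)] that by blast+
    then show ?thesis unfolding new[OF p(1)] by (metis linorder_neqE_nat)
  qed
  have ex: "\<exists>i\<le>D. p \<in> B (Suc (\<kappa> p)) i" if p: "p \<in> space X" for p
  proof -
    have "\<exists>i\<le>D. nb p \<inter> B (\<kappa> p) i = {}"
    proof (rule ccontr)
      assume "\<not> ?thesis"
      then have "\<forall>i. \<exists>q. i \<le> D \<longrightarrow> q \<in> nb p \<inter> B (\<kappa> p) i" by blast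
      then obtain q where q: "\<And>i. i \<le> D \<Longrightarrow> q i \<in> nb p" "\<And>i. i \<le> D \<Longrightarrow> q i \<in> B (\<kappa> p) i" by (metis IntE)
      have inj: "inj_on q {..D}"
      proof (rule inj_onI)
        fix i j assume ij: "i \<in> {..D}" "j \<in> {..D}" "q i = q j"
        then have "q i \<in> B (\<kappa> p) i" "q i \<in> B (\<kappa> p) j" using q(2)[of i] q(2)[of j] by simp_all
        then show "i = j" using uniq by blast
      qed
      have "card (q ` {..D}) \<le> card (nb p)" using q(1) fin[OF p] by (intro card_mono) auto
      then show False using card_image[OF inj] deg[OF p] by simp
    qed
    then obtain i where i: "i \<le> D" "nb p \<inter> B (\<kappa> p) i = {}" by blast
    define l where "l = (LEAST i. nb p \<inter> B (\<kappa> p) i = {})"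
    have "nb p \<inter> B (\<kappa> p) l = {}" unfolding l_def using i(2) by (rule LeastI)
    moreover have "l \<le> D" unfolding l_def
      using Least_le[of "\<lambda>i. nb p \<inter> B (\<kappa> p) i = {}", OF i(2)] i(1) by (rule order_trans)
    moreover have "nb p \<inter> B (\<kappa> p) j \<noteq> {}" if "j < l" for j
      using not_less_Least[OF that[unfolded l_def]] .
    ultimately have "l \<le> D \<and> p \<in> B (Suc (\<kappa> p)) l" using new[OF p] by blast
    then show ?thesis by blast
  qed
  define c where "c = (\<lambda>p. LEAST i. p \<in> B (Suc (\<kappa> p)) i)"
  have cB: "p \<in> B (Suc (\<kappa> p)) (c p)" "c p \<le> D" if p: "p \<in> space X" for p
  proof -
    obtain i where i: "i \<le> D" "p \<in> B (Suc (\<kappa> p)) i" using ex[OF p] by blast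
    then show "p \<in> B (Suc (\<kappa> p)) (c p)" "c p \<le> D" unfolding c_def
      using LeastI[of "\<lambda>i. p \<in> B (Suc (\<kappa> p)) i", OF i(2)] Least_le[of "\<lambda>i. p \<in> B (Suc (\<kappa> p)) i", OF i(2)] by auto
  qed
  have "{p\<in>space X. p \<in> B (Suc (\<kappa> p)) i} \<in> sets X" for i
  proof -
    have "{p\<in>space X. p \<in> B (Suc (\<kappa> p)) i} = (\<Union>n. B n i)"
      using Blt stable by blast
    then show ?thesis using Bm by simp
  qed
  then have "c \<in> measurable X (count_space UNIV)"
    unfolding c_def by (intro measurable_Least) (simp add: pred_def)
  moreover
  have less: "c p \<noteq> c q" if p: "p \<in> space X" and q: "q \<in> nb p" and lt: "\<kappa> q < \<kappa> p" for p q
  proof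
    assume eq: "c p = c q"
    have "q \<in> B (Suc (\<kappa> q)) (c q)" using cB nbS[OF p] q by blast
    then have "q \<in> B (\<kappa> p) (c q)" using stable[OF lt] by blast
    then have "q \<in> nb p \<inter> B (\<kappa> p) (c p)" using q eq by simp
    moreover have "nb p \<inter> B (\<kappa> p) (c p) = {}" using cB(1)[OF p] new[OF p] by blast
    ultimately show False by blast
  qed
  have "c p \<noteq> c q" if p: "p \<in> space X" and q: "q \<in> nb p" for p q
  proof (cases "\<kappa> q < \<kappa> p")
    case False
    have "q \<in> space X" using nbS[OF p] q by blast
    moreover have "\<kappa> p < \<kappa> q" using False \<kappa>(2)[OF p q] by simp
    ultimately show ?thesis using less[of q p] symm[OF p q] by simp
  qed (use less[OF p q] in blast)
  ultimately show ?thesis using cB(2) by blast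
qed

section \<open>Commuting bounded-to-one maps\<close>

lemma standard_borel_separating:
  assumes "standard_borel_space X"
  obtains U :: "nat \<Rightarrow> 'a set" where "\<And>m. U m \<in> sets X"
    "\<And>x y. x \<in> space X \<Longrightarrow> y \<in> space X \<Longrightarrow> (\<And>m. x \<in> U m \<longleftrightarrow> y \<in> U m) \<Longrightarrow> x = y"
proof (rule standard_borel_coding[OF assms])
  fix U :: "nat \<Rightarrow> 'a set"
  assume U: "\<And>m. U m \<in> sets X"
    "\<And>x y. x \<in> space X \<Longrightarrow> y \<in> space X \<Longrightarrow> (\<And>m. x \<in> U m \<longleftrightarrow> y \<in> U m) \<Longrightarrow> x = y"
  show ?thesis by (rule that[of U]) (fact U)+
qed

text \<open>Values are equal iff no separating set distinguishes them, a countable condition. The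
  domain is arbitrary because the result is applied on \<open>X \<Otimes>\<^sub>M X\<close> as well
  as on \<open>X\<close>.\<close>

lemma sets_Collect_eq_standard_borel:
  assumes "standard_borel_space X" "g \<in> measurable M X" "h \<in> measurable M X"
  shows "{x\<in>space M. g x = h x} \<in> sets M"
proof -
  obtain U :: "nat \<Rightarrow> 'a set" where U: "\<And>m. U m \<in> sets X"
    and sep: "\<And>x y. x \<in> space X \<Longrightarrow> y \<in> space X \<Longrightarrow> (\<And>m. x \<in> U m \<longleftrightarrow> y \<in> U m) \<Longrightarrow> x = y"
    using standard_borel_separating[OF assms(1)] by blast
  have pre: "{x\<in>space M. k x \<in> U m} \<in> sets M" if "k \<in> measurable M X" for k m
    using measurable_sets[OF that U[of m]] by (simp only: vimage_def Int_def mem_Collect_eq conj_commute)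
  have "{x\<in>space M. g x = h x} = {x\<in>space M. \<forall>m. (g x \<in> U m \<longrightarrow> h x \<in> U m) \<and> (h x \<in> U m \<longrightarrow> g x \<in> U m)}"
  proof (intro Collect_cong conj_cong refl iffI)
    fix x assume "x \<in> space M" "\<forall>m. (g x \<in> U m \<longrightarrow> h x \<in> U m) \<and> (h x \<in> U m \<longrightarrow> g x \<in> U m)"
    then show "g x = h x"
      by (intro sep measurable_space[OF assms(2)] measurable_space[OF assms(3)]) blast+
  qed simp
  moreover have "\<dots> \<in> sets M"
    by (intro sets.sets_Collect_countable_All sets.sets_Collect_conj sets.sets_Collect_imp pre assms)
  ultimately show ?thesis by (simp only:)
qed

section \<open>The action of exponent vectors\<close>

primrec act_upto :: "(nat \<Rightarrow> 'a \<Rightarrow> 'a) \<Rightarrow> nat \<Rightarrow> (nat \<Rightarrow> nat) \<Rightarrow> 'a \<Rightarrow> 'a" where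
  "act_upto f 0 a x = x"
| "act_upto f (Suc n) a x = (f (Suc n) ^^ a (Suc n)) (act_upto f n a x)"

text \<open>Displacements go along constant vectors. These are cofinal among exponent vectors, and
  the cube of side \<open>2 * T\<close> over a point is the ball of radius \<open>T\<close> around
  the exponent \<open>cst T\<close>.\<close>

definition cst :: "nat \<Rightarrow> nat \<Rightarrow> nat" where "cst K = (\<lambda>_. K)"

lemma cst_apply [simp]: "cst K i = K" by (simp add: cst_def)

lemma cst_add: "cst (K + L) = cst K + cst L" by (simp add: fun_eq_iff)

locale commuting_maps =
  fixes X :: "'a measure" and d :: nat and f :: "nat \<Rightarrow> 'a \<Rightarrow> 'a"
  assumes std: "standard_borel_space X"
    and f_meas: "\<And>i. i \<in> {1..d} \<Longrightarrow> f i \<in> measurable X X"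
    and f_bdd: "\<And>i. i \<in> {1..d} \<Longrightarrow> bounded_to_one_on (space X) (f i)"
    and f_comm: "\<And>i j x. i \<in> {1..d} \<Longrightarrow> j \<in> {1..d} \<Longrightarrow> x \<in> space X \<Longrightarrow> f i (f j x) = f j (f i x)"
begin

definition act :: "(nat \<Rightarrow> nat) \<Rightarrow> 'a \<Rightarrow> 'a" where "act = act_upto f d"

lemma fpow_space: "i \<in> {1..d} \<Longrightarrow> x \<in> space X \<Longrightarrow> (f i ^^ m) x \<in> space X"
  by (induction m) (use measurable_space[OF f_meas] in auto)

lemma act_upto_space: "n \<le> d \<Longrightarrow> x \<in> space X \<Longrightarrow> act_upto f n a x \<in> space X"
  by (induction n) (auto intro!: fpow_space)

lemma act_space [intro, simp]: "x \<in> space X \<Longrightarrow> act a x \<in> space X"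
  unfolding act_def by (rule act_upto_space) auto

lemma fpow_commute1:
  assumes "i \<in> {1..d}" "j \<in> {1..d}" "x \<in> space X"
  shows "f i ((f j ^^ m) x) = (f j ^^ m) (f i x)"
proof (induction m)
  case (Suc m)
  then show ?case using f_comm[OF assms(1,2) fpow_space[OF assms(2,3)], of m] by simp
qed simp

lemma fpow_commute:
  assumes "i \<in> {1..d}" "j \<in> {1..d}" "x \<in> space X"
  shows "(f i ^^ k) ((f j ^^ m) x) = (f j ^^ m) ((f i ^^ k) x)"
proof (induction k)
  case (Suc k)
  then show ?case using fpow_commute1[OF assms(1,2) fpow_space[OF assms(1,3)]] by simp
qed simp

lemma act_upto_commute:
  assumes "i \<in> {1..d}" "n \<le> d" "x \<in> space X"
  shows "(f i ^^ k) (act_upto f n a x) = act_upto f n a ((f i ^^ k) x)"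
  using assms(2)
proof (induction n)
  case (Suc n)
  then show ?case
    using fpow_commute[OF assms(1), of "Suc n" "act_upto f n a x"] act_upto_space[OF _ assms(3), of n a] by simp
qed simp

lemma act_upto_add:
  assumes "n \<le> d" "x \<in> space X"
  shows "act_upto f n (a + b) x = act_upto f n a (act_upto f n b x)"
  using assms(1)
proof (induction n)
  case (Suc n)
  have "act_upto f n a ((f (Suc n) ^^ b (Suc n)) (act_upto f n b x))
      = (f (Suc n) ^^ b (Suc n)) (act_upto f n a (act_upto f n b x))"
    using act_upto_commute[of "Suc n" n "act_upto f n b x" "b (Suc n)" a] act_upto_space[OF _ assms(2)] Suc.prems by simp
  then show ?case using Suc by (simp add: funpow_add)
qed simp

lemma act_add: "x \<in> space X \<Longrightarrow> act (a + b) x = act a (act b x)"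
  unfolding act_def by (rule act_upto_add) auto

lemma act_cong: "(\<And>i. i \<in> {1..d} \<Longrightarrow> a i = b i) \<Longrightarrow> act a = act b"
proof -
  assume *: "\<And>i. i \<in> {1..d} \<Longrightarrow> a i = b i"
  have "n \<le> d \<Longrightarrow> act_upto f n a x = act_upto f n b x" for n x
    by (induction n) (use * in auto)
  then show ?thesis unfolding act_def by (intro ext) auto
qed

lemma act_zero [simp]: "act (cst 0) x = x"
proof -
  have "act_upto f n (cst 0) x = x" for n by (induction n) auto
  then show ?thesis by (simp add: act_def)
qed

definition unit_vec :: "nat \<Rightarrow> nat \<Rightarrow> nat" where "unit_vec i = (\<lambda>j. if j = i then 1 else 0)"

lemma act_unit_vec:
  assumes "i \<in> {1..d}"
  shows "act (unit_vec i) x = f i x"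
proof -
  have "act_upto f n (unit_vec i) x = (if i \<le> n then f i x else x)" for n
    using assms by (induction n) (auto simp: unit_vec_def le_Suc_eq)
  then show ?thesis using assms by (simp add: act_def)
qed

lemma fpow_measurable: "i \<in> {1..d} \<Longrightarrow> (f i ^^ m) \<in> measurable X X"
proof (induction m)
  case (Suc m)
  then show ?case using measurable_comp[OF Suc.IH f_meas[of i]] by (simp add: comp_def)
next
  case 0
  show ?case by (simp add: id_def)
qed

lemma act_upto_measurable: "n \<le> d \<Longrightarrow> act_upto f n a \<in> measurable X X"
proof (induction n)
  case (Suc n)
  then have "act_upto f n a \<in> measurable X X" "(f (Suc n) ^^ a (Suc n)) \<in> measurable X X"
    using fpow_measurable by auto
  then show ?case by (simp add: measurable_compose[where N = X])
next
  case 0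
  have "act_upto f 0 a = id" by (simp add: fun_eq_iff)
  then show ?case by (simp only: measurable_ident)
qed

lemma act_measurable: "act a \<in> measurable X X"
  unfolding act_def by (rule act_upto_measurable) simp

lemma bounded_to_one_comp:
  assumes g: "\<And>y. y \<in> space X \<Longrightarrow> finite {x\<in>space X. g x = y} \<and> card {x\<in>space X. g x = y} \<le> k"
    and h: "\<And>y. y \<in> space X \<Longrightarrow> finite {x\<in>space X. h x = y} \<and> card {x\<in>space X. h x = y} \<le> l"
    and hS: "\<And>x. x \<in> space X \<Longrightarrow> h x \<in> space X" and y: "y \<in> space X"
  shows "finite {x\<in>space X. g (h x) = y} \<and> card {x\<in>space X. g (h x) = y} \<le> k * l"
proof -
  let ?A = "{z\<in>space X. g z = y}"
  have eq: "{x\<in>space X. g (h x) = y} = (\<Union>z\<in>?A. {x\<in>space X. h x = z})" using hS by blast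
  have fin: "finite ?A" and c: "card ?A \<le> k" using g[OF y] by auto
  have "card (\<Union>z\<in>?A. {x\<in>space X. h x = z}) \<le> (\<Sum>z\<in>?A. card {x\<in>space X. h x = z})"
    by (rule card_UN_le[OF fin])
  also have "\<dots> \<le> of_nat (card ?A) * l" by (rule sum_bounded_above) (use h in auto)
  also have "\<dots> \<le> k * l" using c by simp
  finally show ?thesis unfolding eq using fin h by auto
qed

lemma act_bounded_to_one:
  "\<exists>k. \<forall>y\<in>space X. finite {x\<in>space X. act a x = y} \<and> card {x\<in>space X. act a x = y} \<le> k"
proof -
  have one: "\<exists>k. \<forall>y\<in>space X. finite {x\<in>space X. f i x = y} \<and> card {x\<in>space X. f i x = y} \<le> k" if "i \<in> {1..d}" for i
  proof -
    have "f i -` {y} \<inter> space X = {x\<in>space X. f i x = y}" for y by auto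
    then show ?thesis using f_bdd[OF that] unfolding bounded_to_one_on_def by simp
  qed
  have id: "finite {x\<in>space X. x = y} \<and> card {x\<in>space X. x = y} \<le> 1" if "y \<in> space X" for y
  proof -
    have "{x\<in>space X. x = y} = {y}" using that by blast
    then show ?thesis by simp
  qed
  have pow: "\<exists>k. \<forall>y\<in>space X. finite {x\<in>space X. (f i ^^ m) x = y} \<and> card {x\<in>space X. (f i ^^ m) x = y} \<le> k"
    if i: "i \<in> {1..d}" for i m
  proof (induction m)
    case 0
    then show ?case using id by auto
  next
    case (Suc m)
    then obtain k where k: "\<And>y. y\<in>space X \<Longrightarrow> finite {x\<in>space X. (f i ^^ m) x = y} \<and> card {x\<in>space X. (f i ^^ m) x = y} \<le> k" by blast
    obtain l where l: "\<And>y. y\<in>space X \<Longrightarrow> finite {x\<in>space X. f i x = y} \<and> card {x\<in>space X. f i x = y} \<le> l" using one[OF i] by blast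
    show ?case using bounded_to_one_comp[OF l k fpow_space[OF i]] by auto
  qed
  have "n \<le> d \<Longrightarrow> \<exists>k. \<forall>y\<in>space X. finite {x\<in>space X. act_upto f n a x = y} \<and> card {x\<in>space X. act_upto f n a x = y} \<le> k" for n
  proof (induction n)
    case 0
    then show ?case using id by auto
  next
    case (Suc n)
    then obtain k where k: "\<And>y. y\<in>space X \<Longrightarrow> finite {x\<in>space X. act_upto f n a x = y} \<and> card {x\<in>space X. act_upto f n a x = y} \<le> k" by auto
    have "Suc n \<in> {1..d}" using Suc.prems by simp
    from pow[OF this, of "a (Suc n)"]
    obtain l where l: "\<And>y. y\<in>space X \<Longrightarrow> finite {x\<in>space X. (f (Suc n) ^^ a (Suc n)) x = y} \<and> card {x\<in>space X. (f (Suc n) ^^ a (Suc n)) x = y} \<le> l"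
      by blast
    show ?case using bounded_to_one_comp[OF l k act_upto_space] Suc.prems by auto
  qed
  then show ?thesis unfolding act_def by blast
qed

lemma act_image_sets:
  assumes "A \<in> sets X"
  shows "act a ` A \<in> sets X"
proof -
  obtain k where k: "\<And>y. y\<in>space X \<Longrightarrow> finite {x\<in>space X. act a x = y} \<and> card {x\<in>space X. act a x = y} \<le> k"
    using act_bounded_to_one[of a] by blast
  show ?thesis
  proof (rule sets_image_bounded_to_one[OF std act_measurable assms])
    fix y assume y: "y \<in> space X"
    have sub: "{x\<in>A. act a x = y} \<subseteq> {x\<in>space X. act a x = y}" using sets.sets_into_space[OF assms] by blast
    show "finite {x\<in>A. act a x = y} \<and> card {x\<in>A. act a x = y} \<le> k"
      using k[OF y] sub card_mono[OF _ sub] finite_subset[OF sub] by linarith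
  qed
qed

section \<open>Cubes of exponents and a finite colouring of nearby points\<close>

definition cube :: "nat \<Rightarrow> (nat \<Rightarrow> nat) \<Rightarrow> bool" where "cube K a \<longleftrightarrow> (\<forall>i\<in>{1..d}. a i \<le> K)"

text \<open>Vectors are functions on all naturals, so a cube contains infinitely many of them, while
  the action reads only the coordinates in \<open>{1..d}\<close>. Putting 0 elsewhere leaves
  finitely many representatives for unions and sums.\<close>

definition cube_reps :: "nat \<Rightarrow> (nat \<Rightarrow> nat) set" where
  "cube_reps K = {a. \<forall>i. (i \<in> {1..d} \<longrightarrow> a i \<in> {..K}) \<and> (i \<notin> {1..d} \<longrightarrow> a i = 0)}"

lemma finite_cube_reps: "finite (cube_reps K)"
  unfolding cube_reps_def by (rule finite_set_of_finite_funs) auto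

lemma cube_repsD: "a \<in> cube_reps K \<Longrightarrow> cube K a" by (simp add: cube_reps_def cube_def)

lemma cube_cube_reps:
  assumes "cube K a"
  obtains a' where "a' \<in> cube_reps K" "\<And>i. i \<in> {1..d} \<Longrightarrow> a' i = a i" "act a' = act a"
proof (rule that[of "\<lambda>i. if i \<in> {1..d} then a i else 0"])
  show "(\<lambda>i. if i \<in> {1..d} then a i else 0) \<in> cube_reps K" using assms by (simp add: cube_reps_def cube_def)
  show "act (\<lambda>i. if i \<in> {1..d} then a i else 0) = act a" by (rule act_cong) simp
qed simp

lemma cube_mono: "cube K a \<Longrightarrow> K \<le> L \<Longrightarrow> cube L a" unfolding cube_def by fastforce

lemma cube_add: "cube K a \<Longrightarrow> cube L b \<Longrightarrow> cube (K + L) (a + b)"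
  unfolding cube_def by (simp add: add_mono)

lemma cube_cst: "cube K (cst K)" by (simp add: cube_def)

lemma sets_Collect_ex_cube:
  assumes "\<And>a. {x\<in>space X. Q a x} \<in> sets X"
    and "\<And>a b x. (\<And>i. i \<in> {1..d} \<Longrightarrow> a i = b i) \<Longrightarrow> Q a x \<Longrightarrow> Q b x"
  shows "{x\<in>space X. \<exists>a. cube K a \<and> Q a x} \<in> sets X"
proof -
  have "(\<exists>a. cube K a \<and> Q a x) \<longleftrightarrow> (\<exists>a\<in>cube_reps K. Q a x)" for x
  proof
    assume "\<exists>a. cube K a \<and> Q a x"
    then obtain a where a: "cube K a" "Q a x" by blast
    obtain a' where a': "a' \<in> cube_reps K" "\<And>i. i \<in> {1..d} \<Longrightarrow> a' i = a i" using cube_cube_reps[OF a(1)] by metis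
    have "Q a' x" by (rule assms(2)[OF _ a(2)]) (simp add: a'(2))
    then show "\<exists>a\<in>cube_reps K. Q a x" using a'(1) by blast
  qed (use cube_repsD in blast)
  moreover have "{x\<in>space X. \<exists>a\<in>cube_reps K. Q a x} \<in> sets X"
    by (rule sets.sets_Collect_finite_Ex[OF _ finite_cube_reps]) (rule assms(1))
  ultimately show ?thesis by (simp only:)
qed

lemma act_preimage: "B \<in> sets X \<Longrightarrow> {x\<in>space X. act a x \<in> B} \<in> sets X"
  using measurable_sets[OF act_measurable, of B a] by (simp only: vimage_def Int_def mem_Collect_eq conj_commute)

text \<open>Two different points are adjacent if both are images of one point under vectors of the
  cube. The number of such base points behind \<open>p\<close> is bounded, and so is the degree.
  Properness is phrased through the base point, the form in which nearby points occur later.\<close>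

lemma borel_colouring:
  "\<exists>c N. c \<in> measurable X (count_space UNIV) \<and> (\<forall>p\<in>space X. c p < (N::nat)) \<and>
    (\<forall>x\<in>space X. \<forall>a b. cube T a \<longrightarrow> cube T b \<longrightarrow> c (act a x) = c (act b x) \<longrightarrow> act a x = act b x)"
proof -
  obtain U :: "nat \<Rightarrow> 'a set" where U: "\<And>m. U m \<in> sets X"
    and sep: "\<And>x y. x \<in> space X \<Longrightarrow> y \<in> space X \<Longrightarrow> (\<And>m. x \<in> U m \<longleftrightarrow> y \<in> U m) \<Longrightarrow> x = y"
    using standard_borel_separating[OF std] by blast
  define nb where "nb = (\<lambda>p. (\<Union>a\<in>cube_reps T. \<Union>b\<in>cube_reps T. act b ` {x\<in>space X. act a x = p}) - {p})"
  have nb_iff: "q \<in> nb p \<longleftrightarrow> q \<noteq> p \<and> (\<exists>x\<in>space X. \<exists>a\<in>cube_reps T. \<exists>b\<in>cube_reps T. act a x = p \<and> act b x = q)" for p q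
    unfolding nb_def by blast
  have "\<forall>a. \<exists>k. \<forall>y\<in>space X. finite {x\<in>space X. act a x = y} \<and> card {x\<in>space X. act a x = y} \<le> k"
    using act_bounded_to_one by blast
  then obtain k where k: "\<And>a y. y\<in>space X \<Longrightarrow> finite {x\<in>space X. act a x = y}"
      "\<And>a y. y\<in>space X \<Longrightarrow> card {x\<in>space X. act a x = y} \<le> k a" by metis
  define D where "D = (\<Sum>a\<in>cube_reps T. \<Sum>b\<in>cube_reps T. k a)"
  have "\<exists>c :: 'a \<Rightarrow> nat. c \<in> measurable X (count_space UNIV) \<and> (\<forall>p\<in>space X. c p \<le> D)
    \<and> (\<forall>p\<in>space X. \<forall>q\<in>nb p. c p \<noteq> c q)"
  proof (rule finite_borel_colouring[of U X nb D])
    fix p assume p: "p \<in> space X"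
    show "nb p \<subseteq> space X" unfolding nb_def by (auto intro: act_space)
    have fin1: "finite (act b ` {x\<in>space X. act a x = p})" for a b using k(1)[OF p] by blast
    then have fin: "finite (\<Union>a\<in>cube_reps T. \<Union>b\<in>cube_reps T. act b ` {x\<in>space X. act a x = p})"
      using finite_cube_reps by blast
    then show "finite (nb p)" unfolding nb_def by blast
    have "card (nb p) \<le> card (\<Union>a\<in>cube_reps T. \<Union>b\<in>cube_reps T. act b ` {x\<in>space X. act a x = p})"
      unfolding nb_def by (rule card_mono[OF fin]) blast
    also have "\<dots> \<le> (\<Sum>a\<in>cube_reps T. card (\<Union>b\<in>cube_reps T. act b ` {x\<in>space X. act a x = p}))"
      by (rule card_UN_le[OF finite_cube_reps])
    also have "\<dots> \<le> (\<Sum>a\<in>cube_reps T. \<Sum>b\<in>cube_reps T. card (act b ` {x\<in>space X. act a x = p}))"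
      by (intro sum_mono card_UN_le finite_cube_reps)
    also have "\<dots> \<le> D" unfolding D_def
    proof (intro sum_mono)
      fix a b show "card (act b ` {x\<in>space X. act a x = p}) \<le> k a"
        using card_image_le[OF k(1)[OF p], of "act b" a] k(2)[OF p, of a] by (rule order_trans)
    qed
    finally show "card (nb p) \<le> D" .
    show "p \<notin> nb p" unfolding nb_def by blast
  next
    fix p q assume "q \<in> nb p"
    then show "p \<in> nb q" unfolding nb_iff by blast
  next
    fix B assume B: "B \<in> sets X"
    \<comment> \<open>A neighbour is reached by going back along \<open>act a\<close> and forward
      along \<open>act b\<close>. The backward step makes this set a union of images, and here the
      theorem on Borel images enters.\<close>
    have "{p\<in>space X. nb p \<inter> B \<noteq> {}}
      = (\<Union>a\<in>cube_reps T. \<Union>b\<in>cube_reps T. act a ` {x\<in>space X. act b x \<in> B \<and> \<not> act a x = act b x})" (is "?L = ?R")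
    proof (intro equalityI subsetI)
      fix p assume "p \<in> ?L"
      then obtain q where q: "q \<in> nb p" "q \<in> B" by blast
      then obtain x a b where *: "x \<in> space X" "a \<in> cube_reps T" "b \<in> cube_reps T" "act a x = p" "act b x = q" "q \<noteq> p"
        unfolding nb_iff by blast
      show "p \<in> ?R"
      proof (rule UN_I[OF *(2)], rule UN_I[OF *(3)], rule image_eqI)
        show "p = act a x" using *(4) by simp
        show "x \<in> {x\<in>space X. act b x \<in> B \<and> \<not> act a x = act b x}" using * q(2) by simp
      qed
    next
      fix p assume "p \<in> ?R"
      then obtain a b x where *: "a \<in> cube_reps T" "b \<in> cube_reps T" "x \<in> space X" "act b x \<in> B" "act a x \<noteq> act b x" "p = act a x" by blast
      have "act b x \<in> nb p" unfolding nb_iff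
        by (intro conjI bexI[of _ x] bexI[of _ a] bexI[of _ b]) (use * in simp_all)
      then have "act b x \<in> nb p \<inter> B" using *(4) by blast
      then show "p \<in> ?L" using act_space[OF *(3), of a] *(6) by blast
    qed
    moreover have "?R \<in> sets X"
      by (intro sets.finite_UN finite_cube_reps act_image_sets sets.sets_Collect_conj sets.sets_Collect_neg act_preimage B
          sets_Collect_eq_standard_borel[OF std] act_measurable)
    ultimately show "{p\<in>space X. nb p \<inter> B \<noteq> {}} \<in> sets X" by (simp only:)
  qed (fact U sep)+
  then obtain c :: "'a \<Rightarrow> nat" where c: "c \<in> measurable X (count_space UNIV)" "\<And>p. p\<in>space X \<Longrightarrow> c p \<le> D"
    "\<And>p q. p\<in>space X \<Longrightarrow> q\<in>nb p \<Longrightarrow> c p \<noteq> c q" by blast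
  have "act a x = act b x" if x: "x \<in> space X" and ab: "cube T a" "cube T b" and eq: "c (act a x) = c (act b x)" for x a b
  proof (rule ccontr)
    assume ne: "act a x \<noteq> act b x"
    obtain a' where a': "a' \<in> cube_reps T" "act a' = act a" using cube_cube_reps[OF ab(1)] by metis
    obtain b' where b': "b' \<in> cube_reps T" "act b' = act b" using cube_cube_reps[OF ab(2)] by metis
    have "act b x \<in> nb (act a x)" unfolding nb_iff
      by (intro conjI bexI[of _ x] bexI[of _ a'] bexI[of _ b']) (use ne x a' b' in simp_all)
    then show False using c(3)[OF act_space[OF x]] eq by blast
  qed
  then show ?thesis using c(1) c(2) by (intro exI[of _ c] exI[of _ "Suc D"]) (auto simp: le_imp_less_Suc)
qed

section \<open>Separated nets\<close>

definition near :: "nat \<Rightarrow> (nat \<Rightarrow> nat) \<Rightarrow> (nat \<Rightarrow> nat) \<Rightarrow> bool" where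
  "near T u v \<longleftrightarrow> (\<forall>k\<in>{1..d}. u k \<le> v k + T \<and> v k \<le> u k + T)"

lemma nearI: "(\<And>k. k \<in> {1..d} \<Longrightarrow> u k \<le> v k + T \<and> v k \<le> u k + T) \<Longrightarrow> near T u v"
  unfolding near_def by blast

lemma nearD: "near T u v \<Longrightarrow> k \<in> {1..d} \<Longrightarrow> u k \<le> v k + T \<and> v k \<le> u k + T"
  unfolding near_def by blast

lemma near_sym: "near T u v \<Longrightarrow> near T v u"
  unfolding near_def by blast

lemma cubeI: "(\<And>k. k \<in> {1..d} \<Longrightarrow> a k \<le> T) \<Longrightarrow> cube T a"
  unfolding cube_def by blast

lemma cubeD: "cube T a \<Longrightarrow> k \<in> {1..d} \<Longrightarrow> a k \<le> T"
  unfolding cube_def by blast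

text \<open>Only coordinates in \<open>{1..d}\<close> are compared, so truncated differences can
  serve as exponents as soon as they are exact there.\<close>

lemma act_act:
  assumes "x \<in> space X" "\<And>k. k \<in> {1..d} \<Longrightarrow> a k + b k = c k"
  shows "act a (act b x) = act c x"
proof -
  have "act (a + b) = act c" by (rule act_cong) (simp add: assms(2))
  then show ?thesis using act_add[OF assms(1), of a b] by simp
qed

text \<open>A greedy construction along the colours. A rule at the point \<open>p\<close> may only look forward, so membership of \<open>p\<close>
  in \<open>A\<close> is to be read as a statement about the point \<open>act (cst (j * T)) p\<close>, around which a whole neighbourhood is visible.\<close>

lemma maximal_separated_aux:
  fixes c :: "'a \<Rightarrow> nat"
  assumes P: "P \<in> sets X" and cm: "c \<in> measurable X (count_space UNIV)"
    and proper: "\<forall>x\<in>space X. \<forall>a b. cube T a \<longrightarrow> cube T b \<longrightarrow> c (act a x) = c (act b x) \<longrightarrow> act a x = act b x"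
  shows "\<exists>A\<in>sets X. (\<forall>p\<in>space X. p \<in> A \<longrightarrow> act (cst (j * T)) p \<in> P)
    \<and> (\<forall>x\<in>space X. \<forall>u v. near T u v \<longrightarrow> act u x \<in> A \<longrightarrow> act v x \<in> A \<longrightarrow> act (u + cst (j * T)) x = act (v + cst (j * T)) x)
    \<and> (\<forall>p\<in>space X. act (cst (j * T + T)) p \<in> P \<longrightarrow> c (act (cst (j * T + T)) p) < j \<longrightarrow> (\<exists>a. cube (2 * T) a \<and> act a p \<in> A))"
proof (induction j)
  case 0
  show ?case by (rule bexI[of _ "{}"]) auto
next
  case (Suc j)
  define s where "s = j * T"
  obtain A where A: "A \<in> sets X"
    and I1': "\<forall>p\<in>space X. p \<in> A \<longrightarrow> act (cst s) p \<in> P"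
    and I2': "\<forall>x\<in>space X. \<forall>u v. near T u v \<longrightarrow> act u x \<in> A \<longrightarrow> act v x \<in> A \<longrightarrow> act (u + cst s) x = act (v + cst s) x"
    and I3': "\<forall>p\<in>space X. act (cst (s + T)) p \<in> P \<longrightarrow> c (act (cst (s + T)) p) < j \<longrightarrow> (\<exists>a. cube (2 * T) a \<and> act a p \<in> A)"
    using Suc.IH unfolding s_def[symmetric] by (elim bexE conjE)
  note I1 = I1'[rule_format] and I2 = I2'[rule_format] and I3 = I3'[rule_format]
  have s': "Suc j * T = s + T" by (simp add: s_def)
  \<comment> \<open>Old members are read \<open>T\<close> further on, so that old and new members
    have the same displacement \<open>s + T\<close>. The test over the cube of side
    \<open>2 * T\<close> looks at the ball of radius \<open>T\<close> around \<open>cst T\<close>: a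
    point of colour \<open>j\<close> enters only if no old member is near.\<close>
  define A' where "A' = {p\<in>space X. act (cst T) p \<in> A \<or> (act (cst (s + T)) p \<in> P \<and> c (act (cst (s + T)) p) = j
      \<and> \<not> (\<exists>a. cube (2 * T) a \<and> act a p \<in> A))}"
  have A'I1: "p \<in> A'" if "p \<in> space X" "act (cst T) p \<in> A" for p using that unfolding A'_def by blast
  have A'I2: "p \<in> A'" if "p \<in> space X" "act (cst (s + T)) p \<in> P" "c (act (cst (s + T)) p) = j"
     "\<not> (\<exists>a. cube (2 * T) a \<and> act a p \<in> A)" for p
    using that unfolding A'_def by blast
  have A'E: "R" if "p \<in> A'" "act (cst T) p \<in> A \<Longrightarrow> R"
    "act (cst (s + T)) p \<in> P \<Longrightarrow> c (act (cst (s + T)) p) = j \<Longrightarrow> \<not> (\<exists>a. cube (2 * T) a \<and> act a p \<in> A) \<Longrightarrow> R" for p R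
    using that unfolding A'_def by blast
  have A'm: "A' \<in> sets X"
  proof -
    have 1: "{p\<in>space X. c (act (cst (s + T)) p) = j} \<in> sets X"
      using measurable_sets[OF measurable_compose[OF act_measurable cm], of "{j}" "cst (s + T)"]
      by (simp only: vimage_def Int_def mem_Collect_eq conj_commute) simp
    have 2: "{p\<in>space X. \<exists>a. cube (2 * T) a \<and> act a p \<in> A} \<in> sets X"
    proof (rule sets_Collect_ex_cube)
      show "{x \<in> space X. act a x \<in> A} \<in> sets X" for a by (rule act_preimage[OF A])
      fix a b :: "nat \<Rightarrow> nat" and x assume "\<And>i. i \<in> {1..d} \<Longrightarrow> a i = b i" "act a x \<in> A"
      then show "act b x \<in> A" using act_cong[of a b] by simp
    qed
    show ?thesis unfolding A'_def
      by (intro sets.sets_Collect_disj sets.sets_Collect_conj sets.sets_Collect_neg act_preimage A P 1 2)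
  qed
  have J1: "act (cst (s + T)) p \<in> P" if p: "p \<in> space X" "p \<in> A'" for p
  proof (rule A'E[OF p(2)])
    assume "act (cst T) p \<in> A"
    then have "act (cst s) (act (cst T) p) \<in> P" using I1 p by blast
    then show ?thesis using act_act[OF p(1), of "cst s" "cst T" "cst (s + T)"] by simp
  qed
  have mixed: False if x: "x \<in> space X" and uv: "near T u v" and u: "act (cst T) (act u x) \<in> A"
    and v: "\<not> (\<exists>a. cube (2 * T) a \<and> act a (act v x) \<in> A)" for x u v
  proof -
    let ?a = "\<lambda>k. u k + T - v k"
    have "cube (2 * T) ?a" by (rule cubeI) (use nearD[OF uv] in fastforce)
    moreover have "act ?a (act v x) = act (u + cst T) x"
      by (rule act_act[OF x]) (use nearD[OF uv] in fastforce)
    moreover have "act (cst T) (act u x) = act (u + cst T) x" by (rule act_act[OF x]) simp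
    ultimately show False using u v by metis
  qed
  have J2: "act (u + cst (s + T)) x = act (v + cst (s + T)) x"
    if x: "x \<in> space X" and uv: "near T u v" and u: "act u x \<in> A'" and v: "act v x \<in> A'" for x u v
  proof (rule A'E[OF u]; rule A'E[OF v])
    assume *: "act (cst T) (act u x) \<in> A" "act (cst T) (act v x) \<in> A"
    have "act (u + cst T) x \<in> A" "act (v + cst T) x \<in> A"
      using * act_act[OF x, of "cst T" u "u + cst T"] act_act[OF x, of "cst T" v "v + cst T"] by simp_all
    moreover have "near T (u + cst T) (v + cst T)" by (rule nearI) (use nearD[OF uv] in auto)
    ultimately have "act ((u + cst T) + cst s) x = act ((v + cst T) + cst s) x" using I2[OF x] by blast
    then show ?thesis by (simp add: cst_add ac_simps)
  next
    assume *: "act (cst T) (act u x) \<in> A" "\<not> (\<exists>a. cube (2 * T) a \<and> act a (act v x) \<in> A)"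
    then show ?thesis using mixed[OF x uv] by blast
  next
    assume *: "\<not> (\<exists>a. cube (2 * T) a \<and> act a (act u x) \<in> A)" "act (cst T) (act v x) \<in> A"
    then show ?thesis using mixed[OF x near_sym[OF uv]] by blast
  next
    assume *: "c (act (cst (s + T)) (act u x)) = j" "c (act (cst (s + T)) (act v x)) = j"
    \<comment> \<open>The componentwise minimum, displaced by \<open>s + T\<close>, is a base point
      behind both displaced points; from it, equal colours force equality.\<close>
    let ?w = "\<lambda>k. min (u k) (v k) + (s + T)"
    let ?a = "\<lambda>k. u k - min (u k) (v k)" and ?b = "\<lambda>k. v k - min (u k) (v k)"
    have u: "act ?a (act ?w x) = act (u + cst (s + T)) x" "act (cst (s + T)) (act u x) = act (u + cst (s + T)) x"
      by (rule act_act[OF x]; simp)+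
    have v: "act ?b (act ?w x) = act (v + cst (s + T)) x" "act (cst (s + T)) (act v x) = act (v + cst (s + T)) x"
      by (rule act_act[OF x]; simp)+
    have "cube T ?a" "cube T ?b"
      by (rule cubeI; use nearD[OF uv] in fastforce)+
    then have "act ?a (act ?w x) = act ?b (act ?w x)"
      using proper[rule_format, OF act_space[OF x, of ?w], of ?a ?b] * u v by metis
    then show ?thesis using u v by metis
  qed
  have J3: "\<exists>a. cube (2 * T) a \<and> act a p \<in> A'"
    if p: "p \<in> space X" and pP: "act (cst (s + T + T)) p \<in> P" and col: "c (act (cst (s + T + T)) p) < Suc j" for p
  proof -
    let ?q = "act (cst T) p"
    have q: "?q \<in> space X" using p by blast
    have eq: "act (cst (s + T)) ?q = act (cst (s + T + T)) p" by (rule act_act[OF p]) simp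
    show ?thesis
    proof (cases "\<exists>a. cube (2 * T) a \<and> act a ?q \<in> A")
      case True
      then obtain a where a: "cube (2 * T) a" "act a ?q \<in> A" by blast
      have "act a ?q = act (a + cst T) p" by (rule act_act[OF p]) simp
      moreover have "act (cst T) (act a p) = act (a + cst T) p" by (rule act_act[OF p]) simp
      ultimately have "act a p \<in> A'" using A'I1[of "act a p"] a(2) p by simp
      then show ?thesis using a(1) by blast
    next
      case False
      then have "\<not> c (act (cst (s + T)) ?q) < j" using I3[OF q] pP eq by auto
      then have "?q \<in> A'" using A'I2[OF q] False pP col eq by simp
      moreover have "cube (2 * T) (cst T)" by (rule cubeI) simp
      ultimately show ?thesis by blast
    qed
  qed
  show ?case unfolding s'
    by (rule bexI[OF _ A'm], intro conjI ballI allI impI; (rule J1 | rule J2 | rule J3); assumption)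
qed

text \<open>All colours are below \<open>N\<close>, so after \<open>N\<close> stages the restriction
  on colours is void.\<close>

lemma maximal_separated:
  assumes P: "P \<in> sets X"
  shows "\<exists>\<sigma>. \<exists>A\<in>sets X. (\<forall>p\<in>space X. p \<in> A \<longrightarrow> act (cst \<sigma>) p \<in> P)
    \<and> (\<forall>x\<in>space X. \<forall>u v. near T u v \<longrightarrow> act u x \<in> A \<longrightarrow> act v x \<in> A \<longrightarrow> act (u + cst \<sigma>) x = act (v + cst \<sigma>) x)
    \<and> (\<forall>p\<in>space X. act (cst (\<sigma> + T)) p \<in> P \<longrightarrow> (\<exists>a. cube (2 * T) a \<and> act a p \<in> A))"
proof -
  obtain c N where c: "c \<in> measurable X (count_space UNIV)" "\<forall>p\<in>space X. c p < (N::nat)"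
    "\<forall>x\<in>space X. \<forall>a b. cube T a \<longrightarrow> cube T b \<longrightarrow> c (act a x) = c (act b x) \<longrightarrow> act a x = act b x"
    using borel_colouring[of T] by (elim exE conjE)
  have "act a p \<in> P \<longrightarrow> c (act a p) < N" if "p \<in> space X" for a p
    using c(2) act_space[OF that] by blast
  then show ?thesis using maximal_separated_aux[OF P c(1) c(3), of N] by (intro exI[of _ "N * T"]) fastforce
qed

text \<open>Layer \<open>i\<close> is a maximal \<open>4 * L\<close>-separated set of points at distance more than \<open>L\<close> from the earlier layers.\<close>

lemma separated_layers:
  fixes m L :: nat
  shows "\<exists>\<sigma> A. (\<forall>i. A i \<in> sets X)
    \<and> (\<forall>i<m. \<forall>x\<in>space X. \<forall>u v. near (4 * L) u v \<longrightarrow> act u x \<in> A i \<longrightarrow> act v x \<in> A i \<longrightarrow> act (u + cst \<sigma>) x = act (v + cst \<sigma>) x)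
    \<and> (\<forall>i<m. \<forall>j<i. \<forall>x\<in>space X. \<forall>u v. act u x \<in> A i \<longrightarrow> act v x \<in> A j \<longrightarrow> \<not> near L u v)
    \<and> (\<forall>i<m. \<forall>x\<in>space X. \<forall>u. (\<forall>k\<in>{1..d}. 4 * L \<le> u k) \<longrightarrow>
        (\<exists>j<i. \<exists>v. near L u v \<and> act v x \<in> A j) \<or> (\<exists>v. near (4 * L) u v \<and> act v x \<in> A i))"
proof (induction m)
  case 0
  show ?case by (rule exI[of _ 0], rule exI[of _ "\<lambda>_. {}"]) simp
next
  case (Suc m)
  then obtain \<sigma> A where A': "\<forall>i. A i \<in> sets X"
    and sep': "\<forall>i<m. \<forall>x\<in>space X. \<forall>u v. near (4 * L) u v \<longrightarrow> act u x \<in> A i \<longrightarrow> act v x \<in> A i \<longrightarrow> act (u + cst \<sigma>) x = act (v + cst \<sigma>) x"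
    and far': "\<forall>i<m. \<forall>j<i. \<forall>x\<in>space X. \<forall>u v. act u x \<in> A i \<longrightarrow> act v x \<in> A j \<longrightarrow> \<not> near L u v"
    and cov': "\<forall>i<m. \<forall>x\<in>space X. \<forall>u. (\<forall>k\<in>{1..d}. 4 * L \<le> u k) \<longrightarrow>
        (\<exists>j<i. \<exists>v. near L u v \<and> act v x \<in> A j) \<or> (\<exists>v. near (4 * L) u v \<and> act v x \<in> A i)"
    by (elim exE conjE)
  note A = spec[OF A'] and sep = sep'[rule_format] and far = far'[rule_format] and cov = cov'[THEN spec, THEN mp, THEN bspec, THEN spec, THEN mp]
  define P where "P = {p\<in>space X. \<not> (\<exists>j\<in>{..<m}. \<exists>a. cube (2 * L) a \<and> act a p \<in> A j)}"
  have P: "P \<in> sets X"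
  proof -
    have "{p\<in>space X. \<exists>a. cube (2 * L) a \<and> act a p \<in> A j} \<in> sets X" for j
    proof (rule sets_Collect_ex_cube)
      show "{x \<in> space X. act a x \<in> A j} \<in> sets X" for a by (rule act_preimage[OF A])
      fix a b :: "nat \<Rightarrow> nat" and x assume "\<And>i. i \<in> {1..d} \<Longrightarrow> a i = b i" "act a x \<in> A j"
      then show "act b x \<in> A j" using act_cong[of a b] by simp
    qed
    then show ?thesis unfolding P_def
      by (intro sets.sets_Collect_neg sets.sets_Collect_finite_Ex) auto
  qed
  obtain s B where B: "B \<in> sets X" and B1': "\<forall>p\<in>space X. p \<in> B \<longrightarrow> act (cst s) p \<in> P"
    and B2': "\<forall>x\<in>space X. \<forall>u v. near (4 * L) u v \<longrightarrow> act u x \<in> B \<longrightarrow> act v x \<in> B \<longrightarrow> act (u + cst s) x = act (v + cst s) x"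
    and B3': "\<forall>p\<in>space X. act (cst (s + 4 * L)) p \<in> P \<longrightarrow> (\<exists>a. cube (2 * (4 * L)) a \<and> act a p \<in> B)"
    using maximal_separated[OF P, of "4 * L"] by (elim exE bexE conjE)
  note B1 = B1'[rule_format] and B2 = B2'[rule_format] and B3 = B3'[rule_format]
  \<comment> \<open>The exclusion test in \<open>P\<close> is applied after the displacement
    \<open>s\<close> and is centred \<open>L\<close> further on. Reading the earlier layers after
    \<open>s + L\<close> makes distances between old and new layers refer to the same
    exponents.\<close>
  define A' where "A' = (\<lambda>i. if i < m then {p\<in>space X. act (cst (s + L)) p \<in> A i} else B)"
  have A'm: "A' i \<in> sets X" for i
    unfolding A'_def using act_preimage[OF A] B by (cases "i < m") (simp_all only: if_True if_False)
  have A'm': "A' m = B" unfolding A'_def by simp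
  have A'lt: "act u x \<in> A' i \<longleftrightarrow> act (u + cst (s + L)) x \<in> A i" if "i < m" "x \<in> space X" for i u x
  proof -
    have "act (cst (s + L)) (act u x) = act (u + cst (s + L)) x" by (rule act_act[OF that(2)]) simp
    then show ?thesis using that unfolding A'_def by simp
  qed
  have near_shift: "near T (u + w) (v + w)" if "near T u v" for T u v w
    by (rule nearI) (use nearD[OF that] in auto)
  have sep': "act (u + cst (\<sigma> + (s + L))) x = act (v + cst (\<sigma> + (s + L))) x"
    if i: "i < Suc m" and x: "x \<in> space X" and uv: "near (4 * L) u v" and *: "act u x \<in> A' i" "act v x \<in> A' i" for i x u v
  proof (cases "i < m")
    case True
    have "act (u + cst (s + L) + cst \<sigma>) x = act (v + cst (s + L) + cst \<sigma>) x"
      by (rule sep[OF True x near_shift[OF uv]]) (use * A'lt[OF True x] in auto)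
    then show ?thesis by (simp add: cst_add ac_simps)
  next
    case False
    then have "i = m" using i by simp
    then have "act (u + cst s) x = act (v + cst s) x" using B2[OF x uv] * A'm' by simp
    moreover have "act (cst (\<sigma> + L)) (act (w + cst s) x) = act (w + cst (\<sigma> + (s + L))) x" for w
      by (rule act_act[OF x]) simp
    ultimately show ?thesis by metis
  qed
  have far': "\<not> near L u v" if i: "i < Suc m" "j < i" and x: "x \<in> space X" and *: "act u x \<in> A' i" "act v x \<in> A' j" for i j x u v
  proof (cases "i < m")
    case True
    have "\<not> near L (u + cst (s + L)) (v + cst (s + L))"
      by (rule far[OF True i(2) x]) (use * A'lt[OF True x] A'lt[of j x] True i(2) x in auto)
    then show ?thesis using near_shift by blast
  next
    case False
    then have im: "i = m" and jm: "j < m" using i by simp_all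
    show ?thesis
    proof
      assume uv: "near L u v"
      have vj: "act (v + cst (s + L)) x \<in> A j" using * A'lt[OF jm x] by simp
      have "act (cst s) (act u x) \<in> P" using B1[OF act_space[OF x]] * im A'm' by simp
      then have no: "\<not> (\<exists>a. cube (2 * L) a \<and> act a (act (cst s) (act u x)) \<in> A j)" using jm unfolding P_def by blast
      let ?a = "\<lambda>k. v k + L - u k"
      have "act (cst s) (act u x) = act (u + cst s) x" by (rule act_act[OF x]) simp
      moreover have "act ?a (act (u + cst s) x) = act (v + cst (s + L)) x"
        by (rule act_act[OF x]) (use nearD[OF uv] in fastforce)
      moreover have "cube (2 * L) ?a" by (rule cubeI) (use nearD[OF uv] in fastforce)
      ultimately show False using no vj by metis
    qed
  qed
  \<comment> \<open>Here the lower bound \<open>4 * L\<close> on \<open>u\<close> matters: a vector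
    near \<open>u\<close> displaced by \<open>s + L\<close> is at least \<open>s + L\<close>, so it
    can be moved back exactly.\<close>
  have unshift: "\<exists>v'. near T u v' \<and> act v' x \<in> A' j"
    if j: "j < m" and x: "x \<in> space X" and T: "T \<le> 4 * L" and u: "\<forall>k\<in>{1..d}. 4 * L \<le> u k"
      and v: "near T (u + cst (s + L)) v" "act v x \<in> A j" for j x T u v
  proof -
    let ?v = "\<lambda>k. v k - (s + L)"
    have k: "s + L \<le> v k" "u k \<le> ?v k + T \<and> ?v k \<le> u k + T" if "k \<in> {1..d}" for k
      using nearD[OF v(1) that] bspec[OF u that] T by auto
    have "act (?v + cst (s + L)) = act v" by (rule act_cong) (use k(1) in simp)
    then have "act ?v x \<in> A' j" using A'lt[OF j x] v(2) by simp
    moreover have "near T u ?v" by (rule nearI) (rule k(2))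
    ultimately show ?thesis by blast
  qed
  have cov': "(\<exists>j<i. \<exists>v. near L u v \<and> act v x \<in> A' j) \<or> (\<exists>v. near (4 * L) u v \<and> act v x \<in> A' i)"
    if i: "i < Suc m" and x: "x \<in> space X" and u: "\<forall>k\<in>{1..d}. 4 * L \<le> u k" for i x u
  proof (cases "i < m")
    case True
    have "\<forall>k\<in>{1..d}. 4 * L \<le> (u + cst (s + L)) k" using u by auto
    from cov[OF True x this] show ?thesis
    proof
      assume "\<exists>j<i. \<exists>v. near L (u + cst (s + L)) v \<and> act v x \<in> A j"
      then obtain j v where j: "j < i" and v: "near L (u + cst (s + L)) v" "act v x \<in> A j" by blast
      have "j < m" "L \<le> 4 * L" using j True by simp_all
      from unshift[OF this(1) x this(2) u v] show ?thesis using j by blast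
    next
      assume "\<exists>v. near (4 * L) (u + cst (s + L)) v \<and> act v x \<in> A i"
      then obtain v where v: "near (4 * L) (u + cst (s + L)) v" "act v x \<in> A i" by blast
      from unshift[OF True x order_refl u v] show ?thesis by blast
    qed
  next
    case False
    then have im: "i = m" using i by simp
    \<comment> \<open>Seen from \<open>4 * L\<close> behind \<open>u\<close>, the cube of side
      \<open>8 * L\<close> supplied by maximality is the ball of radius \<open>4 * L\<close> around
      \<open>u\<close>.\<close>
    let ?w = "\<lambda>k. u k - 4 * L"
    show ?thesis
    proof (cases "act (u + cst s) x \<in> P")
      case True
      have "act (cst (s + 4 * L)) (act ?w x) = act (u + cst s) x"
        by (rule act_act[OF x]) (use u in auto)
      then obtain a where a: "cube (2 * (4 * L)) a" "act a (act ?w x) \<in> B"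
        using B3[OF act_space[OF x, of ?w]] True by auto
      have "act a (act ?w x) = act (a + ?w) x" by (rule act_act[OF x]) simp
      moreover have "near (4 * L) u (a + ?w)"
      proof (rule nearI)
        fix k assume k: "k \<in> {1..d}"
        then show "u k \<le> (a + ?w) k + 4 * L \<and> (a + ?w) k \<le> u k + 4 * L" using cubeD[OF a(1) k] bspec[OF u k] by simp
      qed
      ultimately show ?thesis using a(2) im A'm' by metis
    next
      case False
      then obtain j a where ja: "j < m" "cube (2 * L) a" "act a (act (u + cst s) x) \<in> A j"
        using act_space[OF x] unfolding P_def by blast
      let ?v = "\<lambda>k. u k + a k - L"
      have k: "L \<le> u k" "u k \<le> ?v k + L \<and> ?v k \<le> u k + L" if "k \<in> {1..d}" for k
        using bspec[OF u that] cubeD[OF ja(2) that] by auto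
      have "act a (act (u + cst s) x) = act (?v + cst (s + L)) x"
        by (rule act_act[OF x]) (use k(1) in force)
      then have "act ?v x \<in> A' j" using A'lt[OF ja(1) x] ja(3) by simp
      moreover have "near L u ?v" by (rule nearI) (rule k(2))
      ultimately show ?thesis using ja(1) im by blast
    qed
  qed
  show ?case
    by (rule exI[of _ "\<sigma> + (s + L)"], rule exI[of _ A'], intro conjI ballI allI impI;
        (rule A'm | rule sep' | rule far' | rule cov'); assumption)
qed

section \<open>Forward maps\<close>

text \<open>A cube of side \<open>8 * L + 1\<close> is covered by \<open>8 ^ d\<close> cubes of side \<open>L + 1\<close>, so
  \<open>8 ^ d + 1\<close> of its points cannot be pairwise more than \<open>L\<close> apart.\<close>

lemma cube_pigeonhole:
  assumes "\<And>i. i < Suc (8 ^ d) \<Longrightarrow> near (4 * L) u (v i)"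
  shows "\<exists>i<Suc (8 ^ d). \<exists>j<i. near L (v i) (v j)"
proof -
  define \<beta> where "\<beta> = (\<lambda>i. \<lambda>k\<in>{1..d}. (v i k + 4 * L - u k) div (L + 1))"
  let ?M = "Suc (8 ^ d)"
  have "\<beta> ` {..<?M} \<subseteq> {1..d} \<rightarrow>\<^sub>E {..<8}"
  proof (intro image_subsetI PiE_I)
    fix i k assume i: "i \<in> {..<?M}" and k: "k \<in> {1..d}"
    have "v i k + 4 * L - u k \<le> 8 * L" using nearD[OF assms[of i] k] i by auto
    then have "(v i k + 4 * L - u k) div (L + 1) < 8" by (intro div_less_iff_less_mult[THEN iffD2]) auto
    then show "\<beta> i k \<in> {..<8}" using k by (simp add: \<beta>_def)
  qed (auto simp: \<beta>_def)
  then have "card (\<beta> ` {..<?M}) \<le> card ({1..d} \<rightarrow>\<^sub>E {..<8::nat})"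
    by (intro card_mono finite_PiE) auto
  also have "\<dots> = 8 ^ d" by (simp add: card_PiE)
  finally have "card (\<beta> ` {..<?M}) < card {..<?M}" by simp
  then have "\<not> inj_on \<beta> {..<?M}" by (rule pigeonhole)
  then obtain i j where ij: "i < ?M" "j < ?M" "i \<noteq> j" "\<beta> i = \<beta> j" unfolding inj_on_def by blast
  have le: "v i k \<le> v j k + L" if "i < ?M" "j < ?M" "\<beta> i = \<beta> j" "k \<in> {1..d}" for i j k
  proof -
    have "\<beta> i k = \<beta> j k" using that(3) by simp
    then have eq: "(v i k + 4 * L - u k) div (L + 1) = (v j k + 4 * L - u k) div (L + 1)"
      using that(4) by (simp add: \<beta>_def)
    have "v i k + 4 * L - u k < (v i k + 4 * L - u k) div (L + 1) * (L + 1) + (L + 1)"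
      using div_mult_mod_eq[of "v i k + 4 * L - u k" "L + 1"] mod_less_divisor[of "L + 1" "v i k + 4 * L - u k"] by linarith
    also have "\<dots> \<le> v j k + 4 * L - u k + (L + 1)"
      unfolding eq using div_mult_mod_eq[of "v j k + 4 * L - u k" "L + 1"] by linarith
    finally show ?thesis using nearD[OF assms[OF that(1)] that(4)] nearD[OF assms[OF that(2)] that(4)] by linarith
  qed
  have n: "near L (v i) (v j)" "near L (v j) (v i)"
    by (rule nearI; use le[OF ij(1,2,4)] le[OF ij(2,1) ij(4)[symmetric]] in blast)+
  show ?thesis
  proof (cases "j < i")
    case True then show ?thesis using ij(1) n(1) by blast
  next
    case False
    then have "i < j" using ij(3) by simp
    then show ?thesis using ij(2) n(2) by blast
  qed
qed

text \<open>If no layer had a point within \<open>L\<close> of the centre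
  \<open>cst (4 * L)\<close>, every layer would have one within \<open>4 * L\<close>, pairwise more
  than \<open>L\<close> apart, against the pigeonhole principle. The centre lies
  \<open>4 * L\<close> ahead because covering is guaranteed only from there on.\<close>

lemma forward_maps:
  "\<exists>K h. (\<forall>i. h i \<in> measurable X X) \<and> (\<forall>i. \<forall>x\<in>space X. \<exists>a. cube K a \<and> h i x = act a x)
    \<and> (\<forall>x\<in>space X. \<exists>i<Suc (8 ^ d). \<forall>a. cube L a \<longrightarrow> h i (act a x) = h i x)"
proof -
  let ?M = "Suc (8 ^ d)"
  obtain \<sigma> A where A': "\<forall>i. A i \<in> sets X"
    and sep': "\<forall>i<?M. \<forall>x\<in>space X. \<forall>u v. near (4 * L) u v \<longrightarrow> act u x \<in> A i \<longrightarrow> act v x \<in> A i \<longrightarrow> act (u + cst \<sigma>) x = act (v + cst \<sigma>) x"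
    and far': "\<forall>i<?M. \<forall>j<i. \<forall>x\<in>space X. \<forall>u v. act u x \<in> A i \<longrightarrow> act v x \<in> A j \<longrightarrow> \<not> near L u v"
    and cov': "\<forall>i<?M. \<forall>x\<in>space X. \<forall>u. (\<forall>k\<in>{1..d}. 4 * L \<le> u k) \<longrightarrow>
        (\<exists>j<i. \<exists>v. near L u v \<and> act v x \<in> A j) \<or> (\<exists>v. near (4 * L) u v \<and> act v x \<in> A i)"
    using separated_layers[of ?M L] by (elim exE conjE)
  note A = spec[OF A'] and sep = sep'[rule_format] and far = far'[rule_format]
    and cov = cov'[THEN spec, THEN mp, THEN bspec, THEN spec, THEN mp]
  have cover: "\<exists>i<?M. \<exists>v. near L (cst (4 * L)) v \<and> act v x \<in> A i" if x: "x \<in> space X" for x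
  proof (rule ccontr)
    assume no: "\<not> ?thesis"
    have big: "\<forall>k\<in>{1..d}. 4 * L \<le> cst (4 * L) k" by simp
    have "\<exists>v. near (4 * L) (cst (4 * L)) v \<and> act v x \<in> A i" if i: "i < ?M" for i
    proof -
      have "\<not> (\<exists>j<i. \<exists>v. near L (cst (4 * L)) v \<and> act v x \<in> A j)" using no i less_trans by blast
      then show ?thesis using cov[OF i x big] by blast
    qed
    then obtain v where v: "\<And>i. i < ?M \<Longrightarrow> near (4 * L) (cst (4 * L)) (v i)" "\<And>i. i < ?M \<Longrightarrow> act (v i) x \<in> A i"
      by metis
    have "\<exists>i<?M. \<exists>j<i. near L (v i) (v j)" by (rule cube_pigeonhole) (rule v(1))
    then obtain i j where ij: "j < i" "i < ?M" "near L (v i) (v j)" by blast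
    have "\<not> near L (v i) (v j)"
      by (rule far[OF ij(2,1) x v(2)[OF ij(2)] v(2)]) (use ij in simp)
    then show False using ij(3) by blast
  qed
  define Q where "Q = (\<lambda>i x v. near (2 * L) (cst (4 * L)) v \<and> act v x \<in> A i)"
  \<comment> \<open>The displacement \<open>\<sigma>\<close> erases the choice made by
    \<open>SOME\<close>, since two candidates are within the separation of the layer. Without a
    candidate the identity is still a bounded forward move.\<close>
  define h where "h = (\<lambda>i x. if i < ?M \<and> (\<exists>v. Q i x v) then act ((SOME v. Q i x v) + cst \<sigma>) x else x)"
  have h_eq: "h i x = act (v + cst \<sigma>) x" if i: "i < ?M" and x: "x \<in> space X" and v: "Q i x v" for i x v
  proof -
    let ?w = "SOME v. Q i x v"
    have w: "Q i x ?w" using v by (rule someI[where P = "Q i x"])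
    have "near (4 * L) ?w v"
    proof (rule nearI)
      fix k assume k: "k \<in> {1..d}"
      have "4 * L \<le> v' k + 2 * L \<and> v' k \<le> 4 * L + 2 * L" if "Q i x v'" for v'
        using nearD[OF _ k, of "2 * L" "cst (4 * L)" v'] that unfolding Q_def by simp
      from this[OF v] this[OF w] show "?w k \<le> v k + 4 * L \<and> v k \<le> ?w k + 4 * L" by linarith
    qed
    then have "act (?w + cst \<sigma>) x = act (v + cst \<sigma>) x"
      using sep[OF i x] v w unfolding Q_def by blast
    then show ?thesis using i v unfolding h_def by auto
  qed
  have h_id: "h i x = x" if "\<not> (i < ?M \<and> (\<exists>v. Q i x v))" for i x using that unfolding h_def by (simp only: if_False)
  have Qcube: "cube (6 * L) v" if "Q i x v" for i x v
    by (rule cubeI) (use that nearD in \<open>fastforce simp: Q_def\<close>)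
  have bdd: "\<exists>a. cube (6 * L + \<sigma>) a \<and> h i x = act a x" if x: "x \<in> space X" for i x
  proof (cases "i < ?M \<and> (\<exists>v. Q i x v)")
    case True
    then obtain v where v: "i < ?M" "Q i x v" by blast
    show ?thesis using h_eq[OF v(1) x v(2)] cube_add[OF Qcube[OF v(2)] cube_cst[of \<sigma>]] by blast
  next
    case False
    have "cube (6 * L + \<sigma>) (cst 0)" by (rule cubeI) simp
    then show ?thesis using h_id[OF False] by (intro exI[of _ "cst 0"]) simp
  qed
  have meas: "h i \<in> measurable X X" for i
  proof (cases "i < ?M")
    case i: True
    show ?thesis
    proof (rule measurableI)
      fix x assume "x \<in> space X"
      then show "h i x \<in> space X" using bdd[of x i] act_space by metis
    next
      fix B assume B: "B \<in> sets X"
      \<comment> \<open>The value does not depend on the candidate, so the preimage is described by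
        existentials over a cube and the choice itself need not be measurable.\<close>
      have "h i -` B \<inter> space X = {x\<in>space X. (\<exists>v. cube (6 * L) v \<and> (Q i x v \<and> act (v + cst \<sigma>) x \<in> B))
         \<or> (\<not> (\<exists>v. cube (6 * L) v \<and> Q i x v) \<and> x \<in> B)}" (is "?L = ?R")
      proof (intro equalityI subsetI)
        fix x assume "x \<in> ?L"
        then have x: "x \<in> space X" "h i x \<in> B" by auto
        show "x \<in> ?R"
        proof (cases "\<exists>v. Q i x v")
          case True
          then obtain v where v: "Q i x v" by blast
          then show ?thesis using x h_eq[OF i x(1) v] Qcube[OF v] by auto
        next
          case False
          then show ?thesis using x h_id[of i x] by simp
        qed
      next
        fix x assume "x \<in> ?R"
        then have x: "x \<in> space X" and
          "(\<exists>v. cube (6 * L) v \<and> (Q i x v \<and> act (v + cst \<sigma>) x \<in> B)) \<or> (\<not> (\<exists>v. cube (6 * L) v \<and> Q i x v) \<and> x \<in> B)"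
          by simp_all
        from this(2) show "x \<in> ?L"
        proof
          assume "\<exists>v. cube (6 * L) v \<and> (Q i x v \<and> act (v + cst \<sigma>) x \<in> B)"
          then show ?thesis using h_eq[OF i x] x by auto
        next
          assume *: "\<not> (\<exists>v. cube (6 * L) v \<and> Q i x v) \<and> x \<in> B"
          then have "\<not> (\<exists>v. Q i x v)" using Qcube by blast
          then show ?thesis using * x h_id[of i x] by simp
        qed
      qed
      moreover have "?R \<in> sets X"
      proof -
        have Qm: "{x\<in>space X. Q i x v} \<in> sets X" for v unfolding Q_def
          by (intro sets.sets_Collect_conj sets.sets_Collect_const act_preimage A)
        have Qc: "Q i x b" if "\<And>i. i \<in> {1..d} \<Longrightarrow> a i = b i" "Q i x a" for a b x
          using that(2) act_cong[OF that(1)] that(1) unfolding Q_def near_def by auto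
        have 1: "{x\<in>space X. \<exists>v. cube (6 * L) v \<and> (Q i x v \<and> act (v + cst \<sigma>) x \<in> B)} \<in> sets X"
        proof (rule sets_Collect_ex_cube)
          show "{x\<in>space X. Q i x a \<and> act (a + cst \<sigma>) x \<in> B} \<in> sets X" for a
            by (intro sets.sets_Collect_conj Qm act_preimage B)
          fix a b :: "nat \<Rightarrow> nat" and x
          assume *: "\<And>i. i \<in> {1..d} \<Longrightarrow> a i = b i" "Q i x a \<and> act (a + cst \<sigma>) x \<in> B"
          have "act (a + cst \<sigma>) = act (b + cst \<sigma>)" by (rule act_cong) (simp add: *(1))
          then show "Q i x b \<and> act (b + cst \<sigma>) x \<in> B" using * Qc[OF *(1)] by simp
        qed
        have 2: "{x\<in>space X. \<exists>v. cube (6 * L) v \<and> Q i x v} \<in> sets X"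
          by (rule sets_Collect_ex_cube[OF Qm]) (rule Qc)
        show ?thesis
          by (intro sets.sets_Collect_disj sets.sets_Collect_conj sets.sets_Collect_neg 1 2 Collect_mem_sets B)
      qed
      ultimately show "h i -` B \<inter> space X \<in> sets X" by (simp only:)
    qed
  next
    case False
    then have "h i = id" using h_id by (simp add: fun_eq_iff)
    then show ?thesis by (simp only: measurable_ident)
  qed
  have const: "\<exists>i<?M. \<forall>a. cube L a \<longrightarrow> h i (act a x) = h i x" if x: "x \<in> space X" for x
  proof -
    obtain i v where i: "i < ?M" and v: "near L (cst (4 * L)) v" "act v x \<in> A i" using cover[OF x] by blast
    have Qv: "Q i x v" unfolding Q_def using v by (auto intro!: nearI dest: nearD)
    have "h i (act a x) = h i x" if a: "cube L a" for a
    proof -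
      \<comment> \<open>The same layer point, now seen from \<open>act a x\<close>. It moves by at
        most \<open>L\<close> relative to the centre, so it is still within
        \<open>2 * L\<close>.\<close>
      let ?v = "\<lambda>k. v k - a k"
      have k: "a k \<le> v k" "cst (4 * L) k \<le> ?v k + 2 * L \<and> ?v k \<le> cst (4 * L) k + 2 * L" if "k \<in> {1..d}" for k
        using nearD[OF v(1) that] cubeD[OF a that] by auto
      have "act ?v (act a x) = act v x" by (rule act_act[OF x]) (use k(1) in simp)
      moreover have "near (2 * L) (cst (4 * L)) ?v" by (rule nearI) (rule k(2))
      ultimately have "Q i (act a x) ?v" unfolding Q_def using v(2) by simp
      then have "h i (act a x) = act (?v + cst \<sigma>) (act a x)" by (rule h_eq[OF i act_space[OF x]])
      also have "\<dots> = act (v + cst \<sigma>) x" by (rule act_act[OF x], drule k(1)) simp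
      finally show ?thesis using h_eq[OF i x Qv] by simp
    qed
    then show ?thesis using i by blast
  qed
  show ?thesis
    by (rule exI[of _ "6 * L + \<sigma>"], rule exI[of _ h]) (intro conjI allI ballI meas bdd const; assumption)
qed

section \<open>Hyperfiniteness\<close>

lemma cube_exists: "\<exists>K. cube K a"
proof
  show "cube (Max (insert 0 (a ` {1..d}))) a" by (rule cubeI) simp
qed

lemma merging_maps:
  "\<exists>g D. (\<forall>i m. g i m \<in> measurable X X) \<and> (\<forall>i m. \<forall>x\<in>space X. \<exists>a. cube (D m) a \<and> g i m x = act a x)
    \<and> (\<forall>i m n x y. m \<le> n \<longrightarrow> g i m x = g i m y \<longrightarrow> g i n x = g i n y)
    \<and> (\<forall>x\<in>space X. \<exists>i::nat. \<forall>a. \<exists>m::nat. g i m (act a x) = g i m x)"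
proof -
  let ?M = "Suc (8 ^ d)"
  have "\<forall>L. \<exists>K h. (\<forall>i. h i \<in> measurable X X) \<and> (\<forall>i. \<forall>x\<in>space X. \<exists>a. cube K a \<and> h i x = act a x)
    \<and> (\<forall>x\<in>space X. \<exists>i<?M. \<forall>a. cube L a \<longrightarrow> h i (act a x) = h i x)"
    using forward_maps by (intro allI)
  then obtain K h where Kh: "\<forall>L. (\<forall>i. h L i \<in> measurable X X) \<and> (\<forall>i. \<forall>x\<in>space X. \<exists>a. cube (K L) a \<and> h L i x = act a x)
    \<and> (\<forall>x\<in>space X. \<exists>i<?M. \<forall>a. cube L a \<longrightarrow> h L i (act a x) = h L i x)"
    by (elim choice[THEN exE] choice[THEN exE])
  have h_meas: "h L i \<in> measurable X X" for L i using Kh by blast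
  have h_cube: "\<exists>a. cube (K L) a \<and> h L i x = act a x" if "x \<in> space X" for L i x using Kh that by blast
  have h_const: "\<exists>i<?M. \<forall>a. cube L a \<longrightarrow> h L i (act a x) = h L i x" if "x \<in> space X" for L x using Kh that by blast
  \<comment> \<open>\<open>D m\<close> bounds how far the first \<open>m\<close> maps move a point.
    The scale \<open>m + D m\<close> of the next map allows for this drift and, through
    \<open>m\<close>, eventually for every vector \<open>a\<close>.\<close>
  define D where "D = rec_nat 0 (\<lambda>m Dm. Dm + K (m + Dm))"
  define g where "g = (\<lambda>i. rec_nat (\<lambda>x. x) (\<lambda>m gm x. h (m + D m) i (gm x)))"
  have D: "D 0 = 0" "D (Suc m) = D m + K (m + D m)" for m by (simp_all add: D_def)
  have g: "g i 0 = (\<lambda>x. x)" "g i (Suc m) = (\<lambda>x. h (m + D m) i (g i m x))" for i m by (simp_all add: g_def)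
  have g_meas: "g i m \<in> measurable X X" for i m
  proof (induction m)
    case (Suc m)
    show ?case unfolding g by (rule measurable_compose[OF Suc h_meas])
  next
    case 0
    show ?case unfolding g by (rule measurable_ident_sets) simp
  qed
  have g_cube: "\<exists>a. cube (D m) a \<and> g i m x = act a x" if x: "x \<in> space X" for i m x
  proof (induction m)
    case 0
    have "cube 0 (cst 0)" by (rule cube_cst)
    then show ?case unfolding g D using act_zero[of x] by metis
  next
    case (Suc m)
    then obtain a where a: "cube (D m) a" "g i m x = act a x" by blast
    obtain b where b: "cube (K (m + D m)) b" "h (m + D m) i (act a x) = act b (act a x)"
      using h_cube[OF act_space[OF x]] by blast
    have "g i (Suc m) x = act (b + a) x" unfolding g using a b act_add[OF x] by simp
    moreover have "cube (D (Suc m)) (b + a)" using cube_add[OF b(1) a(1)] unfolding D by (simp only: add.commute)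
    ultimately show ?case by blast
  qed
  have g_mono: "g i n x = g i n y" if "m \<le> n" "g i m x = g i m y" for i m n x y
    using that by (induction n rule: dec_induct) (simp_all add: g)
  have merge: "\<exists>i. \<forall>a. \<exists>m. g i m (act a x) = g i m x" if x: "x \<in> space X" for x
  proof -
    have "\<forall>m. \<exists>i<?M. \<forall>a. cube (m + D m) a \<longrightarrow> h (m + D m) i (act a x) = h (m + D m) i x"
      using h_const[OF x] by blast
    then obtain \<iota> where \<iota>: "\<And>m. \<iota> m < ?M" "\<And>m a. cube (m + D m) a \<Longrightarrow> h (m + D m) (\<iota> m) (act a x) = h (m + D m) (\<iota> m) x"
      by metis
    have "finite (\<iota> ` UNIV)" by (rule finite_subset[of _ "{..<?M}"]) (use \<iota>(1) in auto)
    then obtain m0 where inf: "infinite {m \<in> UNIV. \<iota> m = \<iota> m0}" using pigeonhole_infinite[of UNIV \<iota>] infinite_UNIV_nat by blast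
    have "\<exists>m. g (\<iota> m0) m (act a x) = g (\<iota> m0) m x" for a
    proof -
      obtain k where k: "cube k a" using cube_exists by blast
      obtain m where m: "m \<ge> k" "\<iota> m = \<iota> m0" using inf unfolding infinite_nat_iff_unbounded_le by blast
      obtain b where b: "cube (D m) b" "g (\<iota> m0) m (act a x) = act b (act a x)" using g_cube[OF act_space[OF x]] by blast
      obtain b' where b': "cube (D m) b'" "g (\<iota> m0) m x = act b' x" using g_cube[OF x] by blast
      \<comment> \<open>Both composites are images of \<open>x\<close> itself under vectors of the
        cube \<open>m + D m\<close>, so at a good scale the next map sends each of them to the same
        value as \<open>x\<close>.\<close>
      have c: "cube (m + D m) (b + a)" "cube (m + D m) b'"
        using cube_add[OF b(1) cube_mono[OF k m(1)]] cube_mono[OF b'(1), of "m + D m"] by (simp_all add: add.commute)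
      have "g (\<iota> m0) (Suc m) (act a x) = g (\<iota> m0) (Suc m) x"
        unfolding g b(2) b'(2) act_add[OF x, symmetric] using \<iota>(2)[OF c(1)] \<iota>(2)[OF c(2)] m(2) by simp
      then show ?thesis by blast
    qed
    then show ?thesis by blast
  qed
  show ?thesis
    by (rule exI[of _ g], rule exI[of _ D]) (intro conjI allI ballI impI g_meas g_cube merge; (assumption | rule g_mono; assumption))
qed

section \<open>The generated graph and its connectedness relation\<close>

abbreviation "G \<equiv> generated_graph (space X) {1..d} f"

lemma sym_graph: "sym G"
  unfolding generated_graph_def sym_def by blast

lemma act_connected:
  assumes x: "x \<in> space X"
  shows "(x, act a x) \<in> G\<^sup>*"
proof -
  have step: "(z, f i z) \<in> G\<^sup>*" if "i \<in> {1..d}" "z \<in> space X" for i z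
  proof (cases "f i z = z")
    case False
    then have "(z, f i z) \<in> G" using that measurable_space[OF f_meas] unfolding generated_graph_def by auto
    then show ?thesis by blast
  qed simp
  have pow: "(z, (f i ^^ m) z) \<in> G\<^sup>*" if "i \<in> {1..d}" "z \<in> space X" for i z m
  proof (induction m)
    case (Suc m)
    have "((f i ^^ m) z, f i ((f i ^^ m) z)) \<in> G\<^sup>*" by (rule step[OF that(1) fpow_space[OF that]])
    with Suc show ?case unfolding funpow.simps comp_apply by (rule rtrancl_trans)
  qed simp
  have "n \<le> d \<Longrightarrow> (x, act_upto f n a x) \<in> G\<^sup>*" for n
  proof (induction n)
    case (Suc n)
    have "(act_upto f n a x, (f (Suc n) ^^ a (Suc n)) (act_upto f n a x)) \<in> G\<^sup>*"
      by (rule pow) (use Suc.prems act_upto_space[OF _ x] in auto)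
    with Suc show ?case unfolding act_upto.simps by (meson Suc_leD rtrancl_trans)
  qed simp
  then show ?thesis unfolding act_def by blast
qed

lemma borel_graph_generated: "borel_graph X G"
proof -
  have "G = {p \<in> space (X \<Otimes>\<^sub>M X). \<not> fst p = snd p \<and> (\<exists>i\<in>{1..d}. f i (fst p) = snd p \<or> f i (snd p) = fst p)}"
    unfolding generated_graph_def space_pair_measure by auto
  moreover have "\<dots> \<in> sets (X \<Otimes>\<^sub>M X)"
    by (intro sets.sets_Collect_conj sets.sets_Collect_neg sets.sets_Collect_finite_Ex sets.sets_Collect_disj
        sets_Collect_eq_standard_borel[OF std] measurable_fst measurable_snd
        measurable_compose[OF measurable_fst f_meas] measurable_compose[OF measurable_snd f_meas] finite_atLeastAtMost)
  ultimately have "G \<in> sets (X \<Otimes>\<^sub>M X)" by (simp only:)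
  then show ?thesis using sym_graph unfolding borel_graph_def generated_graph_def irrefl_def by auto
qed

text \<open>Points merged by different indices are not compared by any single sequence of maps. So
  each point is first moved to a representative ahead of it at which an index common to its whole
  class is good, and then along the maps of that index.\<close>

lemma hyperfinite_connectedness: "hyperfinite_relation X (connectedness_relation (space X) G)"
proof -
  obtain g D where g_meas: "\<forall>i m. g i m \<in> measurable X X"
    and g_cube: "\<forall>i m. \<forall>x\<in>space X. \<exists>a. cube (D m) a \<and> g i m x = act a x"
    and g_mono': "\<forall>i m n x y. m \<le> n \<longrightarrow> g i m x = g i m y \<longrightarrow> g i n x = g i n y"
    and merge: "\<forall>x\<in>space X. \<exists>i::nat. \<forall>a. \<exists>m::nat. g i m (act a x) = g i m x"
    using merging_maps by (elim exE conjE)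
  note g_mono = g_mono'[rule_format]
  define Z where "Z = (\<lambda>i. {x\<in>space X. \<forall>a. \<exists>m. g i m (act a x) = g i m x})"
  have Z_space: "x \<in> space X" if "x \<in> Z i" for x i using that unfolding Z_def by blast
  have ZD: "\<exists>m. g i m (act a x) = g i m x" if "x \<in> Z i" for x i a using that unfolding Z_def by blast
  have Z_act: "act b x \<in> Z i" if x: "x \<in> Z i" for b x i
  proof -
    have "\<exists>m. g i m (act a (act b x)) = g i m (act b x)" for a
    proof -
      obtain m where m: "g i m (act (a + b) x) = g i m x" using ZD[OF x] by blast
      obtain n where n: "g i n (act b x) = g i n x" using ZD[OF x] by blast
      have "g i (max m n) (act (a + b) x) = g i (max m n) (act b x)"
        using g_mono[OF max.cobounded1 m] g_mono[OF max.cobounded2 n] by simp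
      then show ?thesis unfolding act_add[OF Z_space[OF x]] by blast
    qed
    then show ?thesis using act_space[OF Z_space[OF x]] unfolding Z_def by blast
  qed
  have Z_sets: "Z i \<in> sets X" for i
  proof -
    \<comment> \<open>There are uncountably many vectors; bounding them by \<open>K\<close> turns
      the quantifier into countably many finite ones.\<close>
    have "Z i = {x\<in>space X. \<forall>K. \<not> (\<exists>a. cube K a \<and> \<not> (\<exists>m. g i m (act a x) = g i m x))}"
      unfolding Z_def using cube_exists by blast
    moreover have "\<dots> \<in> sets X"
    proof (intro sets.sets_Collect_countable_All sets.sets_Collect_neg sets_Collect_ex_cube)
      show "{x\<in>space X. \<exists>m. g i m (act a x) = g i m x} \<in> sets X" for a
        by (intro sets.sets_Collect_countable_Ex sets_Collect_eq_standard_borel[OF std]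
            measurable_compose[OF act_measurable] g_meas[rule_format])
      fix a b :: "nat \<Rightarrow> nat" and x
      assume "\<And>i. i \<in> {1..d} \<Longrightarrow> a i = b i" "\<not> (\<exists>m. g i m (act a x) = g i m x)"
      then show "\<not> (\<exists>m. g i m (act b x) = g i m x)" using act_cong[of a b] by simp
    qed
    ultimately show ?thesis by (simp only:)
  qed
  \<comment> \<open>Goodness of an index persists forward and constant vectors are cofinal, so
    \<open>y\<close> and \<open>act a y\<close> get the same least index, although the waiting times
    \<open>w\<close> may differ.\<close>
  define \<iota> where "\<iota> = (\<lambda>y. LEAST i. \<exists>w. act (cst w) y \<in> Z i)"
  define w where "w = (\<lambda>y. LEAST w. act (cst w) y \<in> Z (\<iota> y))"
  define rep where "rep = (\<lambda>y. act (cst (w y)) y)"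
  define g' where "g' = (\<lambda>n y. g (\<iota> y) n (rep y))"
  have rep_Z: "rep y \<in> Z (\<iota> y)" if y: "y \<in> space X" for y
  proof -
    obtain i where "y \<in> Z i" using merge y unfolding Z_def by blast
    then have "\<exists>i w. act (cst w) y \<in> Z i" by (intro exI[of _ i] exI[of _ 0]) simp
    then have "\<exists>w. act (cst w) y \<in> Z (\<iota> y)" unfolding \<iota>_def by (rule LeastI_ex)
    then show ?thesis unfolding rep_def w_def by (rule LeastI_ex)
  qed
  have \<iota>_act: "\<iota> (act a y) = \<iota> y" if y: "y \<in> space X" for a y
  proof -
    have "(\<exists>w. act (cst w) (act a y) \<in> Z i) \<longleftrightarrow> (\<exists>w. act (cst w) y \<in> Z i)" for i
    proof
      assume "\<exists>w. act (cst w) (act a y) \<in> Z i"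
      then obtain w where w: "act (cst w) (act a y) \<in> Z i" by blast
      obtain K where K: "cube K a" using cube_exists by blast
      \<comment> \<open>The vector \<open>K - a\<close> completes \<open>a\<close> to the constant
        vector \<open>cst K\<close>.\<close>
      have "act (\<lambda>k. K - a k) (act (cst w) (act a y)) \<in> Z i" by (rule Z_act[OF w])
      moreover have "act (cst w) (act a y) = act (cst w + a) y" by (rule act_add[OF y, symmetric])
      moreover have "act (\<lambda>k. K - a k) (act (cst w + a) y) = act (cst (w + K)) y"
        by (rule act_act[OF y], drule cubeD[OF K]) simp
      ultimately show "\<exists>w. act (cst w) y \<in> Z i" by (intro exI[of _ "w + K"]) simp
    next
      assume "\<exists>w. act (cst w) y \<in> Z i"
      then obtain w where w: "act (cst w) y \<in> Z i" by blast
      have "act a (act (cst w) y) = act (cst w) (act a y)"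
        unfolding act_add[OF y, symmetric] by (simp only: add.commute)
      then show "\<exists>w. act (cst w) (act a y) \<in> Z i" using Z_act[OF w, of a] by auto
    qed
    then show ?thesis unfolding \<iota>_def by simp
  qed
  have \<iota>_meas: "\<iota> \<in> measurable X (count_space UNIV)"
  proof -
    have "{y\<in>space X. \<exists>w. act (cst w) y \<in> Z i} \<in> sets X" for i
      by (intro sets.sets_Collect_countable_Ex act_preimage Z_sets)
    then show ?thesis unfolding \<iota>_def by (intro measurable_Least) (simp only: pred_def)
  qed
  have level: "{y\<in>space M. k y = (i::nat)} \<in> sets M" if "k \<in> measurable M (count_space UNIV)" for k i and M :: "'b measure"
    using measurable_sets[OF that, of "{i}"] by (simp only: vimage_def Int_def mem_Collect_eq conj_commute singleton_iff) simp
  have w_meas: "w \<in> measurable X (count_space UNIV)"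
  proof -
    have "{y\<in>space X. act (cst w) y \<in> Z (\<iota> y)} = {y\<in>space X. \<exists>i. \<iota> y = i \<and> act (cst w) y \<in> Z i}" for w
      by blast
    moreover have "{y\<in>space X. \<exists>i. \<iota> y = i \<and> act (cst w) y \<in> Z i} \<in> sets X" for w
      by (intro sets.sets_Collect_countable_Ex sets.sets_Collect_conj act_preimage Z_sets level[OF \<iota>_meas])
    ultimately have "{y\<in>space X. act (cst w) y \<in> Z (\<iota> y)} \<in> sets X" for w by (simp only:)
    then show ?thesis unfolding w_def by (intro measurable_Least) (simp only: pred_def)
  qed
  have rep_meas: "rep \<in> measurable X X"
    unfolding rep_def by (rule measurable_compose_countable[OF act_measurable w_meas])
  have g'_meas: "g' n \<in> measurable X X" for n
    unfolding g'_def by (rule measurable_compose_countable[OF measurable_compose[OF rep_meas g_meas[rule_format]] \<iota>_meas])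
  \<comment> \<open>Bounding the waiting times by \<open>n\<close> keeps classes finite: points
    related nontrivially reach their common value by vectors of the cube \<open>D n + n\<close>. The
    other points form singleton classes.\<close>
  define Q where "Q = (\<lambda>n. {(y, y'). y \<in> space X \<and> y' \<in> space X \<and>
      (y = y' \<or> w y \<le> n \<and> w y' \<le> n \<and> \<iota> y = \<iota> y' \<and> g' n y = g' n y')})"
  have Q_equiv: "equiv (space X) (Q n)" for n
    by (rule equivI) (auto simp: Q_def refl_on_def sym_def trans_def)
  have Q_sets: "Q n \<in> sets (X \<Otimes>\<^sub>M X)" for n
  proof -
    let ?P = "X \<Otimes>\<^sub>M X"
    have "Q n = {p\<in>space ?P. fst p = snd p \<or> (\<exists>k\<in>{..n}. w (fst p) = k) \<and> (\<exists>k\<in>{..n}. w (snd p) = k)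
        \<and> (\<exists>i. \<iota> (fst p) = i \<and> \<iota> (snd p) = i) \<and> g' n (fst p) = g' n (snd p)}"
      unfolding Q_def space_pair_measure by auto
    moreover have "\<dots> \<in> sets ?P"
      by (intro sets.sets_Collect_conj sets.sets_Collect_disj sets.sets_Collect_finite_Ex finite_atMost
          sets.sets_Collect_countable_Ex sets_Collect_eq_standard_borel[OF std] level
          measurable_fst measurable_snd measurable_compose[OF measurable_fst w_meas] measurable_compose[OF measurable_snd w_meas]
          measurable_compose[OF measurable_fst \<iota>_meas] measurable_compose[OF measurable_snd \<iota>_meas]
          measurable_compose[OF measurable_fst g'_meas] measurable_compose[OF measurable_snd g'_meas])
    ultimately show ?thesis by (simp only:)
  qed
  have g'_cube: "\<exists>a. cube (D n + w y) a \<and> g' n y = act a y" if y: "y \<in> space X" for n y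
  proof -
    obtain a where a: "cube (D n) a" "g (\<iota> y) n (rep y) = act a (rep y)" using g_cube Z_space[OF rep_Z[OF y]] by blast
    have "g' n y = act (a + cst (w y)) y" unfolding g'_def a(2) unfolding rep_def by (rule act_add[OF y, symmetric])
    then show ?thesis using cube_add[OF a(1) cube_cst] by blast
  qed
  have Q_finite: "finite (Q n `` {y})" if y: "y \<in> space X" for n y
  proof -
    have "Q n `` {y} \<subseteq> insert y (\<Union>a\<in>cube_reps (D n + n). {y'\<in>space X. act a y' = g' n y})"
    proof
      fix y' assume "y' \<in> Q n `` {y}"
      then have y': "y' \<in> space X" "y = y' \<or> w y' \<le> n \<and> g' n y = g' n y'" unfolding Q_def by auto
      show "y' \<in> insert y (\<Union>a\<in>cube_reps (D n + n). {y'\<in>space X. act a y' = g' n y})"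
      proof (cases "y = y'")
        case False
        obtain a where a: "cube (D n + w y') a" "g' n y' = act a y'" using g'_cube[OF y'(1)] by blast
        have "cube (D n + n) a" by (rule cube_mono[OF a(1)]) (use y'(2) False in simp)
        then obtain b where b: "b \<in> cube_reps (D n + n)" "act b = act a" using cube_cube_reps by metis
        have "act b y' = g' n y" using y'(2) False a(2) b(2) by simp
        then show ?thesis using y'(1) b(1) by blast
      qed simp
    qed
    moreover have "finite {y'\<in>space X. act a y' = g' n y}" for a
      using act_bounded_to_one[of a] measurable_space[OF g'_meas y] by blast
    ultimately show ?thesis using finite_cube_reps finite_subset by blast
  qed
  have Q_Suc: "Q n \<subseteq> Q (Suc n)" for n
  proof (rule subrelI)
    fix y y' assume yy: "(y, y') \<in> Q n"
    have "\<iota> y = \<iota> y' \<Longrightarrow> g' n y = g' n y' \<Longrightarrow> g' (Suc n) y = g' (Suc n) y'"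
      unfolding g'_def using g_mono[of n "Suc n" "\<iota> y" "rep y" "rep y'"] by simp
    with yy show "(y, y') \<in> Q (Suc n)" unfolding Q_def by auto
  qed
  have Q_mono: "Q m \<subseteq> Q n" if "m \<le> n" for m n using lift_Suc_mono_le[of Q, OF Q_Suc that] .
  let ?R = "\<Union>n. Q n"
  have R_trans: "(x, z) \<in> ?R" if xy: "(x, y) \<in> ?R" and yz: "(y, z) \<in> ?R" for x y z
  proof -
    obtain m n where "(x, y) \<in> Q m" "(y, z) \<in> Q n" using xy yz by blast
    then have "(x, y) \<in> Q (max m n)" "(y, z) \<in> Q (max m n)"
      using Q_mono[OF max.cobounded1] Q_mono[OF max.cobounded2] by blast+
    then show ?thesis using Q_equiv[of "max m n"] unfolding equiv_def trans_def by blast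
  qed
  have R_sym: "(y, x) \<in> ?R" if "(x, y) \<in> ?R" for x y
    using that Q_equiv unfolding equiv_def sym_def by blast
  have R_refl: "(x, x) \<in> ?R" if "x \<in> space X" for x
    using that unfolding Q_def by blast
  have R_step: "(y, f i y) \<in> ?R" if y: "y \<in> space X" and i: "i \<in> {1..d}" for y i
  proof -
    define y' where "y' = f i y"
    have y'_act: "y' = act (unit_vec i) y" unfolding y'_def act_unit_vec[OF i] ..
    have y': "y' \<in> space X" unfolding y'_act using y by blast
    have \<iota>_eq: "\<iota> y' = \<iota> y" unfolding y'_act by (rule \<iota>_act[OF y])
    obtain m where m: "g (\<iota> y) m (act (cst (w y') + unit_vec i) (rep y)) = g (\<iota> y) m (rep y)"
      using ZD[OF rep_Z[OF y]] by blast
    obtain m' where m': "g (\<iota> y) m' (act (cst (w y)) (rep y')) = g (\<iota> y) m' (rep y')"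
      using ZD[OF rep_Z[OF y']] unfolding \<iota>_eq by blast
    \<comment> \<open>By commutativity the two representatives have a common forward image. Each is
      eventually merged with it by the index they share, hence with the other.\<close>
    have common: "act (cst (w y') + unit_vec i) (rep y) = act (cst (w y)) (rep y')"
      unfolding rep_def y'_act act_add[OF y, symmetric] by (simp only: ac_simps)
    define n where "n = max (max m m') (max (w y) (w y'))"
    have n: "m \<le> n" "m' \<le> n" "w y \<le> n" "w y' \<le> n" unfolding n_def by simp_all
    have "g (\<iota> y) n (rep y) = g (\<iota> y) n (rep y')"
      using g_mono[OF n(1) m] g_mono[OF n(2) m'] common by simp
    then have "(y, y') \<in> Q n" unfolding Q_def g'_def using y y' \<iota>_eq n(3,4) by simp
    then show ?thesis unfolding y'_def by blast
  qed
  have conn: "connectedness_relation (space X) G = ?R"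
  proof (intro equalityI subrelI)
    fix x y assume "(x, y) \<in> connectedness_relation (space X) G"
    then have x: "x \<in> space X" and "(x, y) \<in> G\<^sup>*" unfolding connectedness_relation_def by auto
    from this(2) show "(x, y) \<in> ?R"
    proof (induction rule: rtrancl_induct)
      case (step y z)
      then have "y \<in> space X" "z \<in> space X" "\<exists>i\<in>{1..d}. f i y = z \<or> f i z = y" unfolding generated_graph_def by auto
      then have "(y, z) \<in> ?R" using R_step R_sym by metis
      with step.IH show ?case by (rule R_trans)
    qed (rule R_refl[OF x])
  next
    fix x y assume "(x, y) \<in> ?R"
    then obtain n where n: "(x, y) \<in> Q n" by blast
    then have xy: "x \<in> space X" "y \<in> space X" and c: "x = y \<or> g' n x = g' n y" unfolding Q_def by auto
    have "(x, y) \<in> G\<^sup>*"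
    proof (cases "x = y")
      case False
      obtain a b where "g' n x = act a x" "g' n y = act b y" using g'_cube xy by metis
      then have "(x, g' n x) \<in> G\<^sup>*" "(y, g' n x) \<in> G\<^sup>*" using act_connected xy c False by metis+
      then show ?thesis using sym_rtrancl[OF sym_graph] by (meson rtrancl_trans symD)
    qed simp
    then show "(x, y) \<in> connectedness_relation (space X) G" using xy unfolding connectedness_relation_def by simp
  qed
  have R_equiv: "equiv (space X) ?R"
  proof (rule equivI)
    show "?R \<subseteq> space X \<times> space X" unfolding Q_def by auto
    show "refl_on (space X) ?R" unfolding refl_on_def using R_refl by blast
    show "sym ?R" by (rule symI) (rule R_sym)
    show "trans ?R" by (rule transI) (rule R_trans)
  qed
  have "?R \<in> sets (X \<Otimes>\<^sub>M X)" using Q_sets by blast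
  moreover have "countable C" if "C \<in> space X // ?R" for C
  proof -
    obtain y where y: "y \<in> space X" "C = ?R `` {y}" using \<open>C \<in> space X // ?R\<close> by (elim quotientE)
    have "C = (\<Union>n. Q n `` {y})" unfolding y(2) by blast
    then show ?thesis using Q_finite[OF y(1)] by (simp add: countable_finite)
  qed
  moreover have "finite C" if "C \<in> space X // Q n" for C n
    using that Q_finite by (elim quotientE) simp
  ultimately show ?thesis
    unfolding hyperfinite_relation_def countable_borel_equivalence_relation_def borel_equivalence_relation_def conn
    using R_equiv Q_equiv Q_sets Q_Suc by (intro conjI exI[of _ Q]) auto
qed

end

theorem corollary1p3:
  fixes X :: "'a measure" and d :: nat and f :: "nat \<Rightarrow> 'a \<Rightarrow> 'a"
  assumes "standard_borel_space X"
    and "d \<ge> 1"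
    and "\<And>i. i \<in> {1..d} \<Longrightarrow> f i \<in> measurable X X"
    and "\<And>i. i \<in> {1..d} \<Longrightarrow> bounded_to_one_on (space X) (f i)"
    and "\<And>i j x. i \<in> {1..d} \<Longrightarrow> j \<in> {1..d} \<Longrightarrow> x \<in> space X \<Longrightarrow> f i (f j x) = f j (f i x)"
  shows "hyperfinite_graph X (generated_graph (space X) {1..d} f)"
proof -
  interpret commuting_maps X d f by unfold_locales (fact assms)+
  show ?thesis unfolding hyperfinite_graph_def
    using borel_graph_generated hyperfinite_connectedness by (rule conjI)
qed

end
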